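(* Let $\Lambda=k\Lambda_0+\lambda$ be a generic affine weight of non-critical level $k\neq-h^\vee$, and let $\widehat\mu,\widehat\mu'\in(\mathbb C^* )^{r+1}$. The modified Whittaker function $$\widetilde W_\Lambda^{\widehat\mu,\widehat\mu'}(\widehat\phi)=e^{\sum_{i=0}^r\phi_i}\,W_\Lambda^{\widehat\mu,\widehat\mu'}(\widehat\phi)=\sum_{\widehat\beta\in\widehat Q_+}\Big(\prod_{i=0}^r\nu_i^{\beta_i}\Big)e^{(\Lambda+\widehat\rho-\widehat\beta|\widehat\phi)}Z_{\widehat\beta},\qquad \nu_j=d_j\mu_j\mu_j'\ \ (0\le j\le r),$$ satisfies the deformed affine Toda differential equation $$\widehat H\,\widetilde W_\Lambda^{\widehat\mu,\widehat\mu'}(\widehat\phi)=E_\lambda\,\widetilde W_\Lambda^{\widehat\mu,\widehat\mu'}(\widehat\phi),$$ where $$\widehat H=-(k+h^\vee)\,\nu_0\frac{\partial}{\partial\nu_0}+\frac12(\nabla_\phi|\nabla_\phi)+\sum_{j=0}^r\nu_j\,e^{-(\alpha_j|\widehat\phi)},\qquad E_\lambda=\frac12(\lambda+\rho|\lambda+\rho).$$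
   Context: Affine data. $\widehat{\mathfrak g}=\mathfrak n_-\oplus\mathfrak h\oplus\mathfrak n_+$ is the non-twisted affine Lie algebra associated with a finite-dimensional simple Lie algebra $\mathfrak g$ of rank $r$, with simple roots $\alpha_0,\dots,\alpha_r$ ($\alpha_1,\dots,\alpha_r$ those of $\mathfrak g$), Cartan matrix $\widehat C$, and Chevalley generators $e_i,f_i,h_i$, $0\le i\le r$, with $[h_i,h_j]=0$, $[h_i,e_j]=\widehat C_{j,i}e_j$, $[h_i,f_j]=-\widehat C_{j,i}f_j$, $[e_i,f_j]=\delta_{i,j}h_j$ and the Serre relations. The positive numbers $d_i$ satisfy $\widehat C_{i,j}d_j=\widehat C_{j,i}d_i$ and $d_0=1$; $\alpha_i=d_i\alpha_i^\vee$; the symmetric bilinear form satisfies $(\alpha_i|\alpha_j^\vee)=\widehat C_{i,j}$. $\theta=\sum_{i=1}^ra_i\alpha_i$ is the highest root of $\mathfrak g$, $a_0=1$, $\delta=\alpha_0+\theta$; the co-marks are $a_i^\vee=d_ia_i$, $h^\vee=\sum_{i=0}^ra_i^\vee$ is the dual Coxeter number, and $c=\sum_ia_i^\vee h_i$ is central. $(\delta|\alpha_i)=(\delta|\delta)=0$, $(\Lambda_0|\alpha_j^\vee)=\delta_{j,0}$, $(\Lambda_0|\delta)=1$, $(\Lambda_0|\Lambda_0)=0$; $\omega_1,\dots,\omega_r$ are the fundamental weights of $\mathfrak g$, with $(\omega_i|\alpha_j^\vee)=\delta_{i,j}$ for $1\le i,j\le r$, orthogonal to $\delta$ and $\Lambda_0$;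 $\rho=\sum_{i=1}^r\omega_i$; $\widehat\rho=h^\vee\Lambda_0+\rho$, so $(\widehat\rho|\alpha_i^\vee)=1$ for $0\le i\le r$. $\widehat Q_+=\bigoplus_{i=0}^r\mathbb Z_{\ge0}\alpha_i$, and $\widehat\beta=\sum_{i=0}^r\beta_i\alpha_i$. Variables. $\widehat\phi=\sum_{i=0}^r\phi_i\alpha_i^\vee$, $\phi=\sum_{i=1}^r\phi_i\alpha_i^\vee$, $\nabla_\phi=\sum_{i=1}^r\frac{\partial}{\partial\phi_i}\omega_i$, so $(\nabla_\phi|\nabla_\phi)=\sum_{i,j=1}^r(\omega_i|\omega_j)\frac{\partial^2}{\partial\phi_i\partial\phi_j}$. The $\phi_i$ and $\nu_i$ are formal independent variables and the equation is an identity of formal power series in the $\nu_i$. Whittaker function. $\Lambda=k\Lambda_0+\lambda$ with $\lambda$ a weight of $\mathfrak g$ and $k\in\mathbb C$ not a positive integer. $V_\Lambda=U(\mathfrak n_-)|\Lambda\rangle$ is the (irreducible) Verma module, $h_i|\Lambda\rangle=(\Lambda|\alpha_i^\vee)|\Lambda\rangle$, $\mathfrak n_+|\Lambda\rangle=0$, graded by $\widehat Q_+$ ($f_{i_N}\cdots f_{i_1}|\Lambda\rangle$ has degree $\alpha_{i_1}+\dots+\alpha_{i_N}$); its completion is the product of the graded pieces. The dual right module $V_\Lambda^*=\langle\Lambda|U(\mathfrak n_+)$ ($\langle\Lambda|\mathfrak n_-=0$, $\langle\Lambda|h_i=(\Lambda|\alpha_i^\vee)\langle\Lambda|$, $\langle\Lambda|\Lambda\rangle=1$)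 is similarly completed and pairs by $(\langle\Lambda|a)(b|\Lambda\rangle)=\langle\Lambda|ab|\Lambda\rangle$. $|w\rangle^{\widehat\mu}_\Lambda$ is the unique element of the completion of $V_\Lambda$ with $\langle\Lambda|w\rangle=1$, $e_i|w\rangle=\mu_i|w\rangle$ ($0\le i\le r$); ${}^{\widehat\mu'}_\Lambda\langle w|$ is the unique element of the completion of $V_\Lambda^*$ with $\langle w|\Lambda\rangle=1$, $\langle w|f_i=\mu'_i\langle w|$. $W_\Lambda^{\widehat\mu,\widehat\mu'}(\widehat\phi)={}^{\widehat\mu'}_\Lambda\langle w|e^{\sum_{i=0}^r\phi_ih_i}|w\rangle^{\widehat\mu}_\Lambda$, where $e^{\sum_i\phi_ih_i}$ acts on the degree-$\widehat\beta$ piece by $e^{(\Lambda-\widehat\beta|\widehat\phi)}$. Partition function. $\mathcal P_{\widehat\beta}$ is the set of sequences $\mathbf p=(p_0,\dots,p_N)$ in $\widehat Q_+$ with $p_0=0$, $p_N=\widehat\beta$ and each $p_k-p_{k-1}\in\{\alpha_0,\dots,\alpha_r\}$; $Z_{\widehat\beta}=\sum_{\mathbf p\in\mathcal P_{\widehat\beta}}\prod_{k=1}^N\frac1{\widehat v(p_k)}$ with $\widehat v(\widehat\beta)=(\Lambda+\widehat\rho|\widehat\beta)-\frac12(\widehat\beta|\widehat\beta)$. "$\Lambda$ generic" means that $V_\Lambda$ is irreducible and $\widehat v(\widehat\beta)\neq0$ for all $\widehat\beta\in\widehat Q_+\setminus\{0\}$. *)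

theory Defs
  imports "HOL-Analysis.Analysis" "HOL-Library.Poly_Mapping"
begin

text \<open>
  The rank of the finite-dimensional simple Lie algebra is \<open>CARD('n)\<close>. Its Dynkin nodes are
  the elements of \<open>'n\<close>; the nodes of the affine diagram are the elements of \<open>'n option\<close>, with
  \<open>None\<close> as the affine node (index \<open>0\<close>). Definitions that make sense for any set of nodes use
  the type variable \<open>'i\<close>.
\<close>

section \<open>Affine data\<close>

text \<open>
  Cartan matrices of finite-dimensional simple Lie algebras. Convention throughout:
  \<open>C i j = (\<alpha>\<^sub>i | \<alpha>\<^sub>j\<^sup>\<or>)\<close>, the first index being that of the root.
\<close>

definition simple_cartan_matrix :: "('n::finite \<Rightarrow> 'n \<Rightarrow> int) \<Rightarrow> bool" where
  "simple_cartan_matrix A \<longleftrightarrow>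
     (\<forall>i. A i i = 2) \<and>
     (\<forall>i j. i \<noteq> j \<longrightarrow> A i j \<le> 0) \<and>
     (\<forall>i j. A i j = 0 \<longrightarrow> A j i = 0) \<and>
     (\<exists>d :: 'n \<Rightarrow> real. (\<forall>i. 0 < d i) \<and>
        (\<forall>i j. of_int (A i j) * d j = of_int (A j i) * d i) \<and>
        (\<forall>x :: 'n \<Rightarrow> real. x \<noteq> (\<lambda>_. 0) \<longrightarrow>
           0 < (\<Sum>i\<in>UNIV. \<Sum>j\<in>UNIV. x i * x j * (of_int (A i j) * d j)))) \<and>
     (\<forall>S. S \<noteq> {} \<and> S \<noteq> UNIV \<longrightarrow> (\<exists>i\<in>S. \<exists>j\<in>- S. A i j \<noteq> 0))"

text \<open>The root system, in coordinates with respect to the simple roots: the Weyl group orbits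
  of the simple roots.\<close>

inductive_set finite_roots :: "('n::finite \<Rightarrow> 'n \<Rightarrow> int) \<Rightarrow> ('n \<Rightarrow> int) set"
  for A :: "'n \<Rightarrow> 'n \<Rightarrow> int" where
  simple: "(\<lambda>j. if j = i then 1 else 0) \<in> finite_roots A"
| reflect: "\<beta> \<in> finite_roots A \<Longrightarrow> \<beta>(i := \<beta> i - (\<Sum>j\<in>UNIV. \<beta> j * A j i)) \<in> finite_roots A"

definition highest_root :: "('n::finite \<Rightarrow> 'n \<Rightarrow> int) \<Rightarrow> ('n \<Rightarrow> int) \<Rightarrow> bool" where
  "highest_root A \<theta> \<longleftrightarrow> \<theta> \<in> finite_roots A \<and> (\<forall>\<beta>\<in>finite_roots A. \<forall>i. \<beta> i \<le> \<theta> i)"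

text \<open>
  \<open>C\<close> is the Cartan matrix of the non-twisted affine algebra attached to the simple Lie algebra
  with Cartan matrix \<open>C (Some i) (Some j)\<close>, \<open>a\<close> are the marks and \<open>d\<close> the symmetrizing numbers.
  The last clause says that \<open>\<delta> = \<alpha>\<^sub>0 + \<theta>\<close> is orthogonal to all simple coroots; it determines
  the row of \<open>\<alpha>\<^sub>0\<close> and, with \<open>C None None = 2\<close> and \<open>d None = 1\<close>, the remaining column and the
  normalization of \<open>d\<close>.
\<close>

definition untwisted_affine ::
    "('n::finite option \<Rightarrow> 'n option \<Rightarrow> int) \<Rightarrow> ('n option \<Rightarrow> nat) \<Rightarrow> ('n option \<Rightarrow> real) \<Rightarrow> bool" where
  "untwisted_affine C a d \<longleftrightarrow>
     simple_cartan_matrix (\<lambda>i j. C (Some i) (Some j)) \<and>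
     highest_root (\<lambda>i j. C (Some i) (Some j)) (\<lambda>i. int (a (Some i))) \<and>
     a None = 1 \<and> C None None = 2 \<and>
     (\<forall>i. 0 < d i) \<and> d None = 1 \<and>
     (\<forall>i j. of_int (C i j) * d j = of_int (C j i) * d i) \<and>
     (\<forall>j. (\<Sum>i\<in>UNIV. int (a i) * C i j) = 0)"

text \<open>A weight is given by its coordinates in the basis consisting of \<open>\<Lambda>\<^sub>0\<close> (first component)
  and the simple roots \<open>\<alpha>\<^sub>0, \<dots>, \<alpha>\<^sub>r\<close> (second component).\<close>

type_synonym 'n weight = "complex \<times> (complex ^ ('n option))"

definition wscale :: "complex \<Rightarrow> 'n::finite weight \<Rightarrow> 'n weight" where
  "wscale c x = (c * fst x, c *s snd x)"

definition Lambda0 :: "'n::finite weight" where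
  "Lambda0 = (1, 0)"

definition simple_root :: "'n::finite option \<Rightarrow> 'n weight" where
  "simple_root i = (0, axis i 1)"

definition coroot :: "('n::finite option \<Rightarrow> real) \<Rightarrow> 'n option \<Rightarrow> 'n weight" where
  "coroot d i = wscale (1 / of_real (d i)) (simple_root i)"

text \<open>The symmetric bilinear form: \<open>(\<alpha>\<^sub>i | \<alpha>\<^sub>j) = C i j * d j\<close>, \<open>(\<Lambda>\<^sub>0 | \<alpha>\<^sub>j) = \<delta>\<^bsub>j,0\<^esub>\<close>
  (as \<open>d\<^sub>0 = 1\<close>) and \<open>(\<Lambda>\<^sub>0 | \<Lambda>\<^sub>0) = 0\<close>.\<close>

definition form :: "('n::finite option \<Rightarrow> 'n option \<Rightarrow> int) \<Rightarrow> ('n option \<Rightarrow> real)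
    \<Rightarrow> 'n weight \<Rightarrow> 'n weight \<Rightarrow> complex" where
  "form C d x y =
     (\<Sum>i\<in>UNIV. \<Sum>j\<in>UNIV. snd x $ i * snd y $ j * (of_int (C i j) * of_real (d j)))
     + fst x * snd y $ None + fst y * snd x $ None"

definition root_weight :: "('n::finite option \<Rightarrow> nat) \<Rightarrow> 'n weight" where
  "root_weight \<beta> = (\<Sum>i\<in>UNIV. wscale (of_nat (\<beta> i)) (simple_root i))"

definition delta :: "('n::finite option \<Rightarrow> nat) \<Rightarrow> 'n weight" where
  "delta a = root_weight a"

definition fund_weight :: "('n::finite option \<Rightarrow> 'n option \<Rightarrow> int) \<Rightarrow> ('n option \<Rightarrow> nat)
    \<Rightarrow> ('n option \<Rightarrow> real) \<Rightarrow> 'n \<Rightarrow> 'n weight" where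
  "fund_weight C a d i = (THE x.
     (\<forall>j. form C d x (coroot d (Some j)) = (if i = j then 1 else 0)) \<and>
     form C d x (delta a) = 0 \<and> form C d x Lambda0 = 0)"

definition dual_coxeter :: "('n::finite option \<Rightarrow> nat) \<Rightarrow> ('n option \<Rightarrow> real) \<Rightarrow> complex" where
  "dual_coxeter a d = of_real (\<Sum>i\<in>UNIV. d i * of_nat (a i))"

definition rho :: "('n::finite option \<Rightarrow> 'n option \<Rightarrow> int) \<Rightarrow> ('n option \<Rightarrow> nat)
    \<Rightarrow> ('n option \<Rightarrow> real) \<Rightarrow> 'n weight" where
  "rho C a d = (\<Sum>i\<in>UNIV. fund_weight C a d i)"

definition rho_hat :: "('n::finite option \<Rightarrow> 'n option \<Rightarrow> int) \<Rightarrow> ('n option \<Rightarrow> nat)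
    \<Rightarrow> ('n option \<Rightarrow> real) \<Rightarrow> 'n weight" where
  "rho_hat C a d = wscale (dual_coxeter a d) Lambda0 + rho C a d"

text \<open>Weights of the finite-dimensional Lie algebra: the span of \<open>\<alpha>\<^sub>1, \<dots>, \<alpha>\<^sub>r\<close>.\<close>

definition finite_weights :: "'n::finite weight set" where
  "finite_weights = {x. fst x = 0 \<and> snd x $ None = 0}"

definition phi_hat :: "('n::finite option \<Rightarrow> real) \<Rightarrow> ('n option \<Rightarrow> complex) \<Rightarrow> 'n weight" where
  "phi_hat d \<phi> = (\<Sum>i\<in>UNIV. wscale (\<phi> i) (coroot d i))"

section \<open>The enveloping algebra and its Verma modules\<close>

datatype 'i chevalley = Gen_e 'i | Gen_f 'i | Gen_h 'i

text \<open>Words form a monoid under concatenation, so that finitely supported functions on words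
  form the free associative algebra (multiplication from Poly_Mapping).\<close>

instantiation list :: (type) monoid_add
begin
definition zero_list :: "'a list" where "zero_list = []"
definition plus_list :: "'a list \<Rightarrow> 'a list \<Rightarrow> 'a list" where "plus_list xs ys = xs @ ys"
instance by standard (simp_all add: zero_list_def plus_list_def)
end

type_synonym 'i free_alg = "'i chevalley list \<Rightarrow>\<^sub>0 complex"

definition gen :: "'i chevalley \<Rightarrow> 'i free_alg" where
  "gen x = Poly_Mapping.single [x] 1"

definition scalar :: "complex \<Rightarrow> 'i free_alg" where
  "scalar c = Poly_Mapping.single [] c"

definition ad :: "'i free_alg \<Rightarrow> 'i free_alg \<Rightarrow> 'i free_alg" where
  "ad x y = x * y - y * x"

inductive_set chevalley_serre :: "('i \<Rightarrow> 'i \<Rightarrow> int) \<Rightarrow> 'i free_alg set"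
  for C :: "'i \<Rightarrow> 'i \<Rightarrow> int" where
  hh: "ad (gen (Gen_h i)) (gen (Gen_h j)) \<in> chevalley_serre C"
| he: "ad (gen (Gen_h i)) (gen (Gen_e j)) - of_int (C j i) * gen (Gen_e j) \<in> chevalley_serre C"
| hf: "ad (gen (Gen_h i)) (gen (Gen_f j)) + of_int (C j i) * gen (Gen_f j) \<in> chevalley_serre C"
| ef: "ad (gen (Gen_e i)) (gen (Gen_f j)) - (if i = j then gen (Gen_h j) else 0) \<in> chevalley_serre C"
| serre_e: "i \<noteq> j \<Longrightarrow>
    (ad (gen (Gen_e i)) ^^ nat (1 - C j i)) (gen (Gen_e j)) \<in> chevalley_serre C"
| serre_f: "i \<noteq> j \<Longrightarrow>
    (ad (gen (Gen_f i)) ^^ nat (1 - C j i)) (gen (Gen_f j)) \<in> chevalley_serre C"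

text \<open>The enveloping algebra is the quotient of the free algebra by this two-sided ideal.\<close>

inductive_set enveloping_ideal :: "('i \<Rightarrow> 'i \<Rightarrow> int) \<Rightarrow> 'i free_alg set"
  for C :: "'i \<Rightarrow> 'i \<Rightarrow> int" where
  zero: "0 \<in> enveloping_ideal C"
| add: "x \<in> enveloping_ideal C \<Longrightarrow> y \<in> enveloping_ideal C \<Longrightarrow> x + y \<in> enveloping_ideal C"
| rel: "r \<in> chevalley_serre C \<Longrightarrow> x * r * y \<in> enveloping_ideal C"

text \<open>
  Preimages in the free algebra of the left ideal generated by all \<open>e\<^sub>i\<close> and \<open>h\<^sub>i - m\<^sub>i\<close>, and of
  the right ideal generated by all \<open>f\<^sub>i\<close> and \<open>h\<^sub>i - m\<^sub>i\<close>: the annihilators of the left and the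
  right highest weight vector with \<open>h\<^sub>i\<close>-eigenvalues \<open>m i\<close>.
\<close>

inductive_set verma_ideal :: "('i \<Rightarrow> 'i \<Rightarrow> int) \<Rightarrow> ('i \<Rightarrow> complex) \<Rightarrow> 'i free_alg set"
  for C :: "'i \<Rightarrow> 'i \<Rightarrow> int" and m :: "'i \<Rightarrow> complex" where
  env: "x \<in> enveloping_ideal C \<Longrightarrow> x \<in> verma_ideal C m"
| add: "x \<in> verma_ideal C m \<Longrightarrow> y \<in> verma_ideal C m \<Longrightarrow> x + y \<in> verma_ideal C m"
| raise: "x * gen (Gen_e i) \<in> verma_ideal C m"
| cartan: "x * (gen (Gen_h i) - scalar (m i)) \<in> verma_ideal C m"

inductive_set dual_verma_ideal :: "('i \<Rightarrow> 'i \<Rightarrow> int) \<Rightarrow> ('i \<Rightarrow> complex) \<Rightarrow> 'i free_alg set"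
  for C :: "'i \<Rightarrow> 'i \<Rightarrow> int" and m :: "'i \<Rightarrow> complex" where
  env: "x \<in> enveloping_ideal C \<Longrightarrow> x \<in> dual_verma_ideal C m"
| add: "x \<in> dual_verma_ideal C m \<Longrightarrow> y \<in> dual_verma_ideal C m \<Longrightarrow> x + y \<in> dual_verma_ideal C m"
| lower: "gen (Gen_f i) * x \<in> dual_verma_ideal C m"
| cartan: "(gen (Gen_h i) - scalar (m i)) * x \<in> dual_verma_ideal C m"

definition left_act :: "(complex \<Rightarrow> 'v \<Rightarrow> 'v::ab_group_add) \<Rightarrow> ('i chevalley \<Rightarrow> 'v \<Rightarrow> 'v)
    \<Rightarrow> 'i free_alg \<Rightarrow> 'v \<Rightarrow> 'v" where
  "left_act scl act x v = (\<Sum>w\<in>Poly_Mapping.keys x. scl (Poly_Mapping.lookup x w) (foldr act w v))"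

definition right_act :: "(complex \<Rightarrow> 'u \<Rightarrow> 'u::ab_group_add) \<Rightarrow> ('u \<Rightarrow> 'i chevalley \<Rightarrow> 'u)
    \<Rightarrow> 'u \<Rightarrow> 'i free_alg \<Rightarrow> 'u" where
  "right_act scl ract u x = (\<Sum>w\<in>Poly_Mapping.keys x. scl (Poly_Mapping.lookup x w) (foldl ract u w))"

text \<open>
  A complex vector space with scalar multiplication \<open>scl\<close>, generators acting linearly by \<open>act\<close>,
  and a vector \<open>vac\<close> is (a model of) the Verma module iff \<open>x \<mapsto> x \<cdot> vac\<close> identifies it with the
  quotient of the free algebra by \<open>verma_ideal\<close>; likewise for the right module.
\<close>

definition verma_module :: "('i \<Rightarrow> 'i \<Rightarrow> int) \<Rightarrow> ('i \<Rightarrow> complex) \<Rightarrow>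
    (complex \<Rightarrow> 'v \<Rightarrow> 'v::ab_group_add) \<Rightarrow> ('i chevalley \<Rightarrow> 'v \<Rightarrow> 'v) \<Rightarrow> 'v \<Rightarrow> bool" where
  "verma_module C m scl act vac \<longleftrightarrow>
     vector_space scl \<and>
     (\<forall>g. Vector_Spaces.linear scl scl (act g)) \<and>
     (\<forall>v. \<exists>x. v = left_act scl act x vac) \<and>
     (\<forall>x. left_act scl act x vac = 0 \<longleftrightarrow> x \<in> verma_ideal C m)"

definition dual_verma_module :: "('i \<Rightarrow> 'i \<Rightarrow> int) \<Rightarrow> ('i \<Rightarrow> complex) \<Rightarrow>
    (complex \<Rightarrow> 'u \<Rightarrow> 'u::ab_group_add) \<Rightarrow> ('u \<Rightarrow> 'i chevalley \<Rightarrow> 'u) \<Rightarrow> 'u \<Rightarrow> bool" where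
  "dual_verma_module C m scl ract covac \<longleftrightarrow>
     vector_space scl \<and>
     (\<forall>g. Vector_Spaces.linear scl scl (\<lambda>u. ract u g)) \<and>
     (\<forall>u. \<exists>x. u = right_act scl ract covac x) \<and>
     (\<forall>x. right_act scl ract covac x = 0 \<longleftrightarrow> x \<in> dual_verma_ideal C m)"

definition irreducible_module ::
    "(complex \<Rightarrow> 'v \<Rightarrow> 'v::ab_group_add) \<Rightarrow> ('i chevalley \<Rightarrow> 'v \<Rightarrow> 'v) \<Rightarrow> bool" where
  "irreducible_module scl act \<longleftrightarrow>
     (\<exists>v :: 'v. v \<noteq> 0) \<and>
     (\<forall>S. module.subspace scl S \<and> (\<forall>g. \<forall>v\<in>S. act g v \<in> S) \<longrightarrow> S = {0} \<or> S = UNIV)"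

text \<open>The pairing \<open>(\<langle>\<Lambda>|a)(b|\<Lambda>\<rangle>) = \<langle>\<Lambda>|ab|\<Lambda>\<rangle>\<close>, \<open>\<langle>\<Lambda>|\<Lambda>\<rangle> = 1\<close>: the bilinear map that is
  invariant under moving a generator across.\<close>

definition verma_pairing ::
    "(complex \<Rightarrow> 'u \<Rightarrow> 'u::ab_group_add) \<Rightarrow> ('u \<Rightarrow> 'i chevalley \<Rightarrow> 'u) \<Rightarrow> 'u \<Rightarrow>
     (complex \<Rightarrow> 'v \<Rightarrow> 'v::ab_group_add) \<Rightarrow> ('i chevalley \<Rightarrow> 'v \<Rightarrow> 'v) \<Rightarrow> 'v \<Rightarrow>
     ('u \<Rightarrow> 'v \<Rightarrow> complex) \<Rightarrow> bool" where
  "verma_pairing sclU ract covac sclV act vac pair \<longleftrightarrow>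
     (\<forall>u. Vector_Spaces.linear sclV (*) (pair u)) \<and>
     (\<forall>v. Vector_Spaces.linear sclU (*) (\<lambda>u. pair u v)) \<and>
     (\<forall>u g v. pair (ract u g) v = pair u (act g v)) \<and>
     pair covac vac = 1"

section \<open>Whittaker vectors and the Whittaker function\<close>

definition verma_piece :: "(complex \<Rightarrow> 'v \<Rightarrow> 'v::ab_group_add) \<Rightarrow> ('i chevalley \<Rightarrow> 'v \<Rightarrow> 'v) \<Rightarrow> 'v
    \<Rightarrow> ('i \<Rightarrow> nat) \<Rightarrow> 'v set" where
  "verma_piece scl act vac \<beta> =
     module.span scl {foldr act (map Gen_f js) vac | js. \<forall>i. count_list js i = \<beta> i}"

definition dual_verma_piece :: "(complex \<Rightarrow> 'u \<Rightarrow> 'u::ab_group_add) \<Rightarrow> ('u \<Rightarrow> 'i chevalley \<Rightarrow> 'u) \<Rightarrow> 'u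
    \<Rightarrow> ('i \<Rightarrow> nat) \<Rightarrow> 'u set" where
  "dual_verma_piece scl ract covac \<beta> =
     module.span scl {foldl ract covac (map Gen_e js) | js. \<forall>i. count_list js i = \<beta> i}"

text \<open>
  An element of the completion is the family \<open>w\<close> of its homogeneous components. Since \<open>e\<^sub>i\<close> maps
  degree \<open>\<beta> + \<alpha>\<^sub>i\<close> to degree \<open>\<beta>\<close> (and kills degrees without \<open>\<alpha>\<^sub>i\<close>), \<open>e\<^sub>i |w\<rangle> = \<mu>\<^sub>i |w\<rangle>\<close> is the
  componentwise equation below; the same holds for \<open>f\<^sub>i\<close> acting on the right module.
\<close>

definition whittaker_vector :: "(complex \<Rightarrow> 'v \<Rightarrow> 'v::ab_group_add) \<Rightarrow> ('i chevalley \<Rightarrow> 'v \<Rightarrow> 'v) \<Rightarrow> 'v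
    \<Rightarrow> 'u \<Rightarrow> ('u \<Rightarrow> 'v \<Rightarrow> complex) \<Rightarrow> ('i \<Rightarrow> complex) \<Rightarrow> (('i \<Rightarrow> nat) \<Rightarrow> 'v) \<Rightarrow> bool" where
  "whittaker_vector scl act vac covac pair \<mu> w \<longleftrightarrow>
     (\<forall>\<beta>. w \<beta> \<in> verma_piece scl act vac \<beta>) \<and>
     pair covac (w (\<lambda>_. 0)) = 1 \<and>
     (\<forall>i \<beta>. act (Gen_e i) (w (\<beta>(i := \<beta> i + 1))) = scl (\<mu> i) (w \<beta>))"

definition whittaker_covector :: "(complex \<Rightarrow> 'u \<Rightarrow> 'u::ab_group_add) \<Rightarrow> ('u \<Rightarrow> 'i chevalley \<Rightarrow> 'u) \<Rightarrow> 'u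
    \<Rightarrow> 'v \<Rightarrow> ('u \<Rightarrow> 'v \<Rightarrow> complex) \<Rightarrow> ('i \<Rightarrow> complex) \<Rightarrow> (('i \<Rightarrow> nat) \<Rightarrow> 'u) \<Rightarrow> bool" where
  "whittaker_covector scl ract covac vac pair \<mu>' w' \<longleftrightarrow>
     (\<forall>\<beta>. w' \<beta> \<in> dual_verma_piece scl ract covac \<beta>) \<and>
     pair (w' (\<lambda>_. 0)) vac = 1 \<and>
     (\<forall>i \<beta>. ract (w' (\<beta>(i := \<beta> i + 1))) (Gen_f i) = scl (\<mu>' i) (w' \<beta>))"

text \<open>
  The Whittaker function is a formal sum over \<open>\<beta>\<close> of functions of \<open>\<phi>\<close> (pieces of distinct degrees
  being orthogonal); \<open>whittaker_fun \<dots> \<beta> \<phi>\<close> is its term of degree \<open>\<beta>\<close>.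
\<close>

definition torus_exp :: "('n::finite option \<Rightarrow> 'n option \<Rightarrow> int) \<Rightarrow> ('n option \<Rightarrow> real) \<Rightarrow>
    'n weight \<Rightarrow> (complex \<Rightarrow> 'v \<Rightarrow> 'v) \<Rightarrow> ('n option \<Rightarrow> complex) \<Rightarrow>
    (('n option \<Rightarrow> nat) \<Rightarrow> 'v) \<Rightarrow> (('n option \<Rightarrow> nat) \<Rightarrow> 'v)" where
  "torus_exp C d \<Lambda> scl \<phi> w =
     (\<lambda>\<beta>. scl (exp (form C d (\<Lambda> - root_weight \<beta>) (phi_hat d \<phi>))) (w \<beta>))"

definition whittaker_fun :: "('n::finite option \<Rightarrow> 'n option \<Rightarrow> int) \<Rightarrow> ('n option \<Rightarrow> real) \<Rightarrow>
    'n weight \<Rightarrow> (complex \<Rightarrow> 'v \<Rightarrow> 'v) \<Rightarrow> ('u \<Rightarrow> 'v \<Rightarrow> complex) \<Rightarrow>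
    (('n option \<Rightarrow> nat) \<Rightarrow> 'u) \<Rightarrow> (('n option \<Rightarrow> nat) \<Rightarrow> 'v) \<Rightarrow>
    ('n option \<Rightarrow> nat) \<Rightarrow> ('n option \<Rightarrow> complex) \<Rightarrow> complex" where
  "whittaker_fun C d \<Lambda> scl pair w' w \<beta> \<phi> = pair (w' \<beta>) (torus_exp C d \<Lambda> scl \<phi> w \<beta>)"

definition modified_whittaker_fun :: "('n::finite option \<Rightarrow> 'n option \<Rightarrow> int) \<Rightarrow> ('n option \<Rightarrow> real) \<Rightarrow>
    'n weight \<Rightarrow> (complex \<Rightarrow> 'v \<Rightarrow> 'v) \<Rightarrow> ('u \<Rightarrow> 'v \<Rightarrow> complex) \<Rightarrow>
    (('n option \<Rightarrow> nat) \<Rightarrow> 'u) \<Rightarrow> (('n option \<Rightarrow> nat) \<Rightarrow> 'v) \<Rightarrow>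
    ('n option \<Rightarrow> nat) \<Rightarrow> ('n option \<Rightarrow> complex) \<Rightarrow> complex" where
  "modified_whittaker_fun C d \<Lambda> scl pair w' w \<beta> \<phi> =
     exp (\<Sum>i\<in>UNIV. \<phi> i) * whittaker_fun C d \<Lambda> scl pair w' w \<beta> \<phi>"

section \<open>The partition function\<close>

definition vhat :: "('n::finite option \<Rightarrow> 'n option \<Rightarrow> int) \<Rightarrow> ('n option \<Rightarrow> nat) \<Rightarrow>
    ('n option \<Rightarrow> real) \<Rightarrow> 'n weight \<Rightarrow> ('n option \<Rightarrow> nat) \<Rightarrow> complex" where
  "vhat C a d \<Lambda> \<beta> = form C d (\<Lambda> + rho_hat C a d) (root_weight \<beta>)
     - 1/2 * form C d (root_weight \<beta>) (root_weight \<beta>)"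

definition root_paths :: "('i \<Rightarrow> nat) \<Rightarrow> ('i \<Rightarrow> nat) list set" where
  "root_paths \<beta> = {p. p \<noteq> [] \<and> hd p = (\<lambda>_. 0) \<and> last p = \<beta> \<and>
     (\<forall>k. Suc k < length p \<longrightarrow> (\<exists>i. p ! Suc k = (p ! k)(i := (p ! k) i + 1)))}"

definition partition_fun :: "('n::finite option \<Rightarrow> 'n option \<Rightarrow> int) \<Rightarrow> ('n option \<Rightarrow> nat) \<Rightarrow>
    ('n option \<Rightarrow> real) \<Rightarrow> 'n weight \<Rightarrow> ('n option \<Rightarrow> nat) \<Rightarrow> complex" where
  "partition_fun C a d \<Lambda> \<beta> =
     (\<Sum>p\<in>root_paths \<beta>. \<Prod>k = 1..length p - 1. 1 / vhat C a d \<Lambda> (p ! k))"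

section \<open>Formal power series in the variables \<open>\<nu>\<^sub>i\<close> and the Toda operator\<close>

text \<open>\<open>G \<beta>\<close> is the coefficient of \<open>\<Prod>\<^sub>i \<nu>\<^sub>i ^ \<beta> i\<close>, a function of \<open>\<phi>\<close>.\<close>

type_synonym 'i nu_series = "('i \<Rightarrow> nat) \<Rightarrow> ('i \<Rightarrow> complex) \<Rightarrow> complex"

text \<open>Reads a formal sum \<open>\<Sum>\<^sub>\<beta> T \<beta>\<close>, whose degree \<open>\<beta>\<close> term carries the monomial
  \<open>\<Prod>\<^sub>i \<nu>\<^sub>i ^ \<beta> i\<close> (with all \<open>\<nu>\<^sub>i \<noteq> 0\<close>), as the power series of the coefficients of these
  monomials.\<close>

definition nu_expansion :: "('i::finite \<Rightarrow> complex) \<Rightarrow> (('i \<Rightarrow> nat) \<Rightarrow> ('i \<Rightarrow> complex) \<Rightarrow> complex)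
    \<Rightarrow> 'i nu_series" where
  "nu_expansion \<nu> T = (\<lambda>\<beta> \<phi>. T \<beta> \<phi> / (\<Prod>i\<in>UNIV. \<nu> i ^ \<beta> i))"

definition nu_mult :: "'i \<Rightarrow> 'i nu_series \<Rightarrow> 'i nu_series" where
  "nu_mult j G = (\<lambda>\<beta> \<phi>. if \<beta> j = 0 then 0 else G (\<beta>(j := \<beta> j - 1)) \<phi>)"

definition nu_deriv :: "'i \<Rightarrow> 'i nu_series \<Rightarrow> 'i nu_series" where
  "nu_deriv j G = (\<lambda>\<beta> \<phi>. of_nat (\<beta> j + 1) * G (\<beta>(j := \<beta> j + 1)) \<phi>)"

definition phi_deriv :: "'i \<Rightarrow> 'i nu_series \<Rightarrow> 'i nu_series" where
  "phi_deriv i G = (\<lambda>\<beta> \<phi>. deriv (\<lambda>t. G \<beta> (\<phi>(i := t))) (\<phi> i))"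

definition toda_operator :: "('n::finite option \<Rightarrow> 'n option \<Rightarrow> int) \<Rightarrow> ('n option \<Rightarrow> nat) \<Rightarrow>
    ('n option \<Rightarrow> real) \<Rightarrow> complex \<Rightarrow> 'n option nu_series \<Rightarrow> 'n option nu_series" where
  "toda_operator C a d k G = (\<lambda>\<beta> \<phi>.
     - (k + dual_coxeter a d) * nu_mult None (nu_deriv None G) \<beta> \<phi>
     + 1/2 * (\<Sum>i\<in>UNIV. \<Sum>j\<in>UNIV. form C d (fund_weight C a d i) (fund_weight C a d j)
           * phi_deriv (Some i) (phi_deriv (Some j) G) \<beta> \<phi>)
     + (\<Sum>j\<in>UNIV. exp (- form C d (simple_root j) (phi_hat d \<phi>)) * nu_mult j G \<beta> \<phi>))"

end

theory Submission
  imports Defs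
begin

text \<open>
  Write \<open>v\<close> for \<open>vhat\<close> and \<open>w\<^sub>\<beta>\<close> for the components of the Whittaker vector. The element
  \<open>x\<^sub>\<beta> = v(\<beta>) w\<^sub>\<beta> - \<Sum>\<^sub>i d\<^sub>i \<mu>\<^sub>i f\<^sub>i w\<^bsub>\<beta>-\<alpha>\<^sub>i\<^esub>\<close>
  satisfies \<open>e\<^sub>j x\<^sub>\<beta> = \<mu>\<^sub>j x\<^bsub>\<beta>-\<alpha>\<^sub>j\<^esub>\<close>, because \<open>v(\<beta>) - v(\<beta>-\<alpha>\<^sub>j)\<close> is \<open>d\<^sub>j\<close> times the eigenvalue of
  \<open>h\<^sub>j\<close> in degree \<open>\<beta>-\<alpha>\<^sub>j\<close>. As \<open>x\<^sub>0 = 0\<close>, the element \<open>x\<^sub>\<beta>\<close> is orthogonal to the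
  degree \<open>\<beta>\<close> piece of the dual module, and pairing it with the Whittaker covector yields
  \<open>v(\<beta>) \<langle>w'\<^sub>\<beta>, w\<^sub>\<beta>\<rangle> = \<Sum>\<^sub>i \<nu>\<^sub>i \<langle>w'\<^bsub>\<beta>-\<alpha>\<^sub>i\<^esub>, w\<^bsub>\<beta>-\<alpha>\<^sub>i\<^esub>\<rangle>\<close>. This argument replaces the Casimir element. Splitting off
  the last step of a path gives the same recursion \<open>v(\<beta>) Z\<^sub>\<beta> = \<Sum>\<^sub>i Z\<^bsub>\<beta>-\<alpha>\<^sub>i\<^esub>\<close>, which is also the
  Toda equation: the differential part of the operator acts on the degree \<open>\<beta>\<close> term by the energy minus \<open>v(\<beta>)\<close>.
\<close>

section \<open>Verma modules and Whittaker vectors\<close>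

text \<open>Writing a value at a fresh key is the same as adding a \<open>single\<close>. Additive
  identities in the free algebra thus need checking on monomials only.\<close>

lemma poly_mapping_add_induct [case_names zero single add]:
  assumes "P 0" "\<And>k v. P (Poly_Mapping.single k v)" "\<And>x y. P x \<Longrightarrow> P y \<Longrightarrow> P (x + y)"
  shows "P (x :: 'a \<Rightarrow>\<^sub>0 'b::ab_group_add)"
proof (induction x rule: update_induct)
  case const
  then show ?case using assms(1) .
next
  case (update f k v)
  have "Poly_Mapping.update k v f = f + Poly_Mapping.single k v"
    using update(1)
    by (intro poly_mapping_eqI)
      (auto simp: lookup_update lookup_add lookup_single not_in_keys_iff_lookup_eq_zero when_def)
  then show ?case using assms update by simp
qed

section \<open>Action of the free algebra through words in the generators\<close>

locale chevalley_action = vector_space scl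
  for scl :: "complex \<Rightarrow> 'v \<Rightarrow> 'v::ab_group_add" +
  fixes act :: "'i chevalley \<Rightarrow> 'v \<Rightarrow> 'v"
  assumes linear_act: "Vector_Spaces.linear scl scl (act g)"
begin

lemma act_add: "act g (x + y) = act g x + act g y"
  and act_diff: "act g (x - y) = act g x - act g y"
  and act_scale: "act g (scl c x) = scl c (act g x)"
  and act_0 [simp]: "act g 0 = 0"
  and act_sum: "act g (sum f S) = (\<Sum>i\<in>S. act g (f i))"
proof -
  interpret l: Vector_Spaces.linear scl scl "act g" by (rule linear_act)
  show "act g (x + y) = act g x + act g y" "act g (x - y) = act g x - act g y"
    "act g (scl c x) = scl c (act g x)" "act g 0 = 0" "act g (sum f S) = (\<Sum>i\<in>S. act g (f i))"
    by (rule l.add l.diff l.scale l.zero l.sum)+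
qed

text \<open>Words outside the support contribute zero. Summing over one common finite set makes the
  actions of two elements comparable, as additivity requires.\<close>

lemma left_act_superset:
  assumes "finite S" "Poly_Mapping.keys x \<subseteq> S"
  shows "left_act scl act x v = (\<Sum>w\<in>S. scl (Poly_Mapping.lookup x w) (foldr act w v))"
  unfolding left_act_def using assms
  by (intro sum.mono_neutral_left) (auto simp: in_keys_iff)

lemma left_act_0 [simp]: "left_act scl act 0 v = 0"
  by (simp add: left_act_def)

lemma left_act_single [simp]: "left_act scl act (Poly_Mapping.single w c) v = scl c (foldr act w v)"
  by (subst left_act_superset[of "{w}"]) auto

lemma left_act_add: "left_act scl act (x + y) v = left_act scl act x v + left_act scl act y v"
proof -
  let ?S = "Poly_Mapping.keys x \<union> Poly_Mapping.keys y"
  show ?thesis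
    using keys_add[of x y]
    by (simp add: left_act_superset[of ?S] lookup_add scale_left_distrib sum.distrib)
qed

lemma left_act_diff: "left_act scl act (x - y) v = left_act scl act x v - left_act scl act y v"
  using left_act_add[of "x - y" y v] by (simp add: algebra_simps)

text \<open>Monomials multiply by concatenating words, and \<open>foldr\<close> turns concatenation
  into composition. Both sides are additive in \<open>y\<close>, which reduces the claim to
  monomials.\<close>

lemma left_act_single_mult:
  "left_act scl act (Poly_Mapping.single u c * y) v = scl c (foldr act u (left_act scl act y v))"
proof -
  have fold_add: "foldr act u (x + y) = foldr act u x + foldr act u y" for u x y
    by (induction u) (simp_all add: act_add)
  have fold_scale: "foldr act u (scl c x) = scl c (foldr act u x)" for u c x
    by (induction u) (simp_all add: act_scale)
  have fold_zero: "foldr act u 0 = 0" for u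
    by (induction u) simp_all
  show ?thesis
  proof (induction y rule: poly_mapping_add_induct)
    case (single k v)
    then show ?case by (simp add: mult_single plus_list_def fold_scale)
  next
    case (add x y)
    then show ?case by (simp add: distrib_left left_act_add fold_add scale_right_distrib)
  qed (simp add: fold_zero)
qed

lemma left_act_gen_mult: "left_act scl act (gen g * y) v = act g (left_act scl act y v)"
  by (simp add: gen_def left_act_single_mult)

lemma left_act_of_int_mult:
  "left_act scl act (of_int k * y) v = scl (of_int k) (left_act scl act y v)"
  unfolding single_of_int[symmetric] by (simp add: left_act_single_mult zero_list_def)

end

section \<open>Commutation relations, weights and graded pieces of the Verma module\<close>

locale verma_action =
  fixes C :: "'i::finite \<Rightarrow> 'i \<Rightarrow> int" and m :: "'i \<Rightarrow> complex"
    and scl :: "complex \<Rightarrow> 'v \<Rightarrow> 'v::ab_group_add" and act :: "'i chevalley \<Rightarrow> 'v \<Rightarrow> 'v" and vac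
  assumes verma: "verma_module C m scl act vac"

sublocale verma_action \<subseteq> chevalley_action scl act
  using verma unfolding verma_module_def chevalley_action_def chevalley_action_axioms_def by auto

context verma_action
begin

lemma act_e_vac [simp]: "act (Gen_e i) vac = 0"
proof -
  have "1 * gen (Gen_e i) \<in> verma_ideal C m" by (rule verma_ideal.raise)
  then have "left_act scl act (gen (Gen_e i)) vac = 0"
    using verma unfolding verma_module_def by simp
  then show ?thesis by (simp add: gen_def)
qed

lemma act_h_vac: "act (Gen_h i) vac = scl (m i) vac"
proof -
  have "1 * (gen (Gen_h i) - scalar (m i)) \<in> verma_ideal C m" by (rule verma_ideal.cartan)
  then have "left_act scl act (gen (Gen_h i) - scalar (m i)) vac = 0"
    using verma unfolding verma_module_def by simp
  then show ?thesis by (simp add: gen_def scalar_def left_act_diff)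
qed

text \<open>The vector \<open>vac\<close> is cyclic, and the two-sided ideal generated by the
  relations lies in its annihilator. So \<open>r * x\<close> kills \<open>vac\<close> for every
  \<open>x\<close>, and the relation holds on every vector of the module.\<close>

lemma relation_acts_trivially:
  assumes "r \<in> chevalley_serre C"
  shows "\<exists>x. v = left_act scl act x vac \<and> left_act scl act (r * x) vac = 0"
proof -
  obtain x where x: "v = left_act scl act x vac"
    using verma unfolding verma_module_def by blast
  have "1 * r * x \<in> verma_ideal C m"
    by (intro verma_ideal.env enveloping_ideal.rel assms)
  then have "left_act scl act (r * x) vac = 0"
    using verma unfolding verma_module_def by simp
  with x show ?thesis by blast
qed

lemma act_e_f:
  "act (Gen_e i) (act (Gen_f j) v) = act (Gen_f j) (act (Gen_e i) v) + (if i = j then act (Gen_h j) v else 0)"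
proof -
  obtain x where x: "v = left_act scl act x vac"
    and r: "left_act scl act ((ad (gen (Gen_e i)) (gen (Gen_f j))
      - (if i = j then gen (Gen_h j) else 0)) * x) vac = 0"
    using relation_acts_trivially[OF chevalley_serre.ef] by blast
  from r show ?thesis
    unfolding x by (cases "i = j")
      (simp_all add: ad_def left_diff_distrib left_act_diff mult.assoc left_act_gen_mult diff_eq_eq add.commute)
qed

lemma act_h_f:
  "act (Gen_h i) (act (Gen_f j) v) = act (Gen_f j) (act (Gen_h i) v) - scl (of_int (C j i)) (act (Gen_f j) v)"
proof -
  obtain x where x: "v = left_act scl act x vac"
    and r: "left_act scl act ((ad (gen (Gen_h i)) (gen (Gen_f j)) + of_int (C j i) * gen (Gen_f j)) * x) vac = 0"
    using relation_acts_trivially[OF chevalley_serre.hf] by blast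
  from r show ?thesis
    unfolding x by (simp add: ad_def left_diff_distrib distrib_right left_act_diff left_act_add
        mult.assoc left_act_gen_mult left_act_of_int_mult algebra_simps)
qed

text \<open>A monomial of degree \<beta> contains no \<open>Gen_f i\<close>, so
  \<open>Gen_e i\<close> commutes past all its letters and reaches \<open>vac\<close>.\<close>

lemma act_e_piece:
  assumes "v \<in> verma_piece scl act vac \<beta>" "\<beta> i = 0"
  shows "act (Gen_e i) v = 0"
proof -
  have *: "act (Gen_e i) (foldr act (map Gen_f js) vac) = 0" if "i \<notin> set js" for js
    using that by (induction js) (auto simp: act_e_f)
  show ?thesis
    using assms(1) unfolding verma_piece_def
  proof (induction rule: span_induct_alt)
    case (step c x y)
    then obtain js where js: "x = foldr act (map Gen_f js) vac" "\<forall>i. count_list js i = \<beta> i"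
      by blast
    then have "i \<notin> set js" using assms(2) by (metis count_list_0_iff)
    with * js step show ?case by (simp add: act_add act_scale)
  qed simp
qed

text \<open>Moving \<open>Gen_h i\<close> past \<open>Gen_f j\<close> lowers the eigenvalue by
  \<open>C j i\<close>. The total over a word depends only on how often each letter occurs, that is,
  on the degree.\<close>

lemma act_h_piece:
  assumes "v \<in> verma_piece scl act vac \<beta>"
  shows "act (Gen_h i) v = scl (m i - (\<Sum>j\<in>UNIV. of_nat (\<beta> j) * of_int (C j i))) v"
proof -
  have *: "act (Gen_h i) (foldr act (map Gen_f js) vac)
      = scl (m i - (\<Sum>j\<leftarrow>js. of_int (C j i))) (foldr act (map Gen_f js) vac)" for js
    by (induction js) (simp_all add: act_h_vac act_h_f act_scale flip: scale_left_diff_distrib)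
  have **: "(\<Sum>j\<leftarrow>js. of_int (C j i)) = (\<Sum>j\<in>UNIV. of_nat (\<beta> j) * of_int (C j i) :: complex)"
    if "\<forall>i. count_list js i = \<beta> i" for js
  proof -
    have "(\<Sum>j\<leftarrow>js. of_int (C j i)) = (\<Sum>j\<in>UNIV. of_nat (count_list js j) * of_int (C j i) :: complex)"
    proof (induction js)
      case (Cons l js)
      have "(\<Sum>j\<in>UNIV. of_nat (count_list (l # js) j) * of_int (C j i) :: complex)
        = (\<Sum>j\<in>UNIV. (if j = l then of_int (C j i) else 0) + of_nat (count_list js j) * of_int (C j i))"
        by (intro sum.cong) (auto simp: algebra_simps)
      then show ?case using Cons by (simp add: sum.distrib)
    qed simp
    then show ?thesis using that by simp
  qed
  show ?thesis
    using assms(1) unfolding verma_piece_def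
  proof (induction rule: span_induct_alt)
    case (step c x y)
    then obtain js where js: "x = foldr act (map Gen_f js) vac" "\<forall>i. count_list js i = \<beta> i"
      by blast
    show ?case unfolding act_add act_scale step.IH using *[of js] **[OF js(2)] js(1)
      by (simp add: scale_right_distrib mult.commute)
  qed simp
qed

lemma count_list_zero: "(\<forall>i. count_list js i = 0) \<longleftrightarrow> js = []"
  by (cases js) auto

lemma piece_0: "verma_piece scl act vac (\<lambda>_. 0) = range (\<lambda>c. scl c vac)"
  by (simp add: verma_piece_def count_list_zero span_singleton)

end

section \<open>Recursion for the pairing of the Whittaker components\<close>

text \<open>The component in degree \<beta> minus \<open>\<alpha>\<^sub>j\<close>, extended by zero
  outside the positive cone, where subtraction of naturals would truncate instead.\<close>

definition shift :: "'i \<Rightarrow> (('i \<Rightarrow> nat) \<Rightarrow> 'v) \<Rightarrow> ('i \<Rightarrow> nat) \<Rightarrow> 'v::zero" where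
  "shift j w \<beta> = (if \<beta> j = 0 then 0 else w (\<beta>(j := \<beta> j - 1)))"

lemma shift_commute: "shift i (shift j w) = shift j (shift i w)"
  by (rule ext) (auto simp: shift_def fun_upd_twist)

text \<open>Only the start value and the increments of \<open>v\<close> enter; \<open>vhat\<close>
  with \<open>s = d\<close> is the intended instance. The difference of the two sides is the pairing
  of a monomial covector with \<open>x\<close>, and the letters of the monomial are moved across one
  by one until degree zero is reached.\<close>

lemma (in verma_action) whittaker_vector_recursion:
  fixes v :: "('i \<Rightarrow> nat) \<Rightarrow> complex" and s :: "'i \<Rightarrow> complex" and pair :: "'u \<Rightarrow> 'v \<Rightarrow> complex"
  assumes w: "whittaker_vector scl act vac covac pair \<mu> w"
    and pair_lin: "\<And>u. Vector_Spaces.linear scl (*) (pair u)"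
    and pair_inv: "\<And>u g x. pair (ract u g) x = pair u (act g x)"
    and v0: "v (\<lambda>_. 0) = 0"
    and v_step: "\<And>\<beta> j. v (\<beta>(j := \<beta> j + 1)) - v \<beta> = s j * (m j - (\<Sum>l\<in>UNIV. of_nat (\<beta> l) * of_int (C l j)))"
    and count: "\<forall>i. count_list js i = \<beta> i"
  shows "v \<beta> * pair (foldl ract covac (map Gen_e js)) (w \<beta>)
    = (\<Sum>i\<in>UNIV. s i * \<mu> i * pair (foldl ract covac (map Gen_e js)) (act (Gen_f i) (shift i w \<beta>)))"
proof -
  have piece: "w \<beta> \<in> verma_piece scl act vac \<beta>" for \<beta>
    using w by (simp add: whittaker_vector_def)
  have eig: "act (Gen_e j) (w \<beta>) = scl (\<mu> j) (shift j w \<beta>)" for j \<beta>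
  proof (cases "\<beta> j = 0")
    case True
    then show ?thesis using act_e_piece[OF piece] by (simp add: shift_def)
  next
    case False
    have "act (Gen_e j) (w (\<gamma>(j := \<gamma> j + 1))) = scl (\<mu> j) (w \<gamma>)" for \<gamma>
      using w by (simp add: whittaker_vector_def)
    from this[of "\<beta>(j := \<beta> j - 1)"] show ?thesis using False by (simp add: shift_def)
  qed
  have eig_shift: "act (Gen_e j) (shift i w \<beta>) = scl (\<mu> j) (shift i (shift j w) \<beta>)" for i j \<beta>
    by (simp add: shift_def eig)
  define x where "x \<beta> = scl (v \<beta>) (w \<beta>) - (\<Sum>i\<in>UNIV. scl (s i * \<mu> i) (act (Gen_f i) (shift i w \<beta>)))" for \<beta>
  have x0: "x (\<lambda>_. 0) = 0"
    by (simp add: x_def v0 shift_def)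
  have x_step: "act (Gen_e j) (x (\<beta>(j := \<beta> j + 1))) = scl (\<mu> j) (x \<beta>)" for j \<beta>
  proof -
    let ?b = "\<beta>(j := \<beta> j + 1)"
    define r where "r = m j - (\<Sum>l\<in>UNIV. of_nat (\<beta> l) * of_int (C l j))"
    have sj: "shift j u ?b = u \<beta>" for u :: "('i \<Rightarrow> nat) \<Rightarrow> 'v"
      by (simp add: shift_def)
    \<comment> \<open>The commutator appears only for \<open>i = j\<close>. There the shifted
      component is \<open>w \<beta>\<close>, on which \<open>Gen_h j\<close> has eigenvalue
      \<open>r\<close>.\<close>
    have "act (Gen_e j) (act (Gen_f i) (shift i w ?b))
        = scl (\<mu> j) (act (Gen_f i) (shift i w \<beta>)) + (if i = j then scl r (w \<beta>) else 0)" for i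
      unfolding act_e_f eig_shift act_scale shift_commute[of i j] sj
      by (cases "i = j") (simp_all only: sj act_h_piece[OF piece] r_def if_True if_False refl simp_thms eq_commute[of j i])
    then have "act (Gen_e j) (x ?b) = scl (v ?b * \<mu> j) (w \<beta>)
        - (\<Sum>i\<in>UNIV. scl (s i * \<mu> i * \<mu> j) (act (Gen_f i) (shift i w \<beta>))
            + (if i = j then scl (s i * \<mu> i * r) (w \<beta>) else 0))"
      by (simp only: x_def act_diff act_scale act_sum eig sj scale_scale scale_right_distrib
          if_distrib[where f="scl _"] scale_zero_right)
    also have "\<dots> = scl ((v ?b - s j * r) * \<mu> j) (w \<beta>)
        - (\<Sum>i\<in>UNIV. scl (s i * \<mu> i * \<mu> j) (act (Gen_f i) (shift i w \<beta>)))"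
      by (simp add: sum.distrib scale_left_diff_distrib left_diff_distrib)
    \<comment> \<open>The increment of \<open>v\<close> is exactly what absorbs the commutator
      term.\<close>
    also have "v ?b - s j * r = v \<beta>"
      using v_step[of \<beta> j] unfolding r_def by (metis diff_diff_eq2 add_diff_cancel_left')
    also have "scl (v \<beta> * \<mu> j) (w \<beta>)
        - (\<Sum>i\<in>UNIV. scl (s i * \<mu> i * \<mu> j) (act (Gen_f i) (shift i w \<beta>))) = scl (\<mu> j) (x \<beta>)"
      by (simp add: x_def scale_right_diff_distrib scale_sum_right mult.commute)
    finally show ?thesis .
  qed
  have vanish: "pair (foldl ract covac (map Gen_e js)) (x \<beta>) = 0"
    if "\<forall>i. count_list js i = \<beta> i" for js \<beta>
    using that
  \<comment> \<open>Under \<open>foldl\<close> the last letter acts last on the covector, so it is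
    the one that invariance of the pairing moves onto \<open>x\<close>.\<close>
  proof (induction js arbitrary: \<beta> rule: rev_induct)
    case Nil
    interpret p: Vector_Spaces.linear scl "(*)" "pair covac" by (rule pair_lin)
    from Nil have "\<beta> = (\<lambda>_. 0)" by (intro ext) (metis count_list.simps(1))
    then show ?case using x0 p.zero by simp
  next
    case (snoc j js)
    interpret p: Vector_Spaces.linear scl "(*)" "pair (foldl ract covac (map Gen_e js))"
      by (rule pair_lin)
    let ?g = "\<beta>(j := \<beta> j - 1)"
    have c: "\<forall>i. count_list js i = ?g i"
    proof
      show "count_list js i = ?g i" for i
        using snoc.prems[rule_format, of i] by (cases "i = j") auto
    qed
    have "\<beta> j \<noteq> 0" using snoc.prems[rule_format, of j] by simp
    then have eq: "act (Gen_e j) (x \<beta>) = scl (\<mu> j) (x ?g)" using x_step[of j ?g] by simp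
    have "pair (foldl ract covac (map Gen_e (js @ [j]))) (x \<beta>)
        = \<mu> j * pair (foldl ract covac (map Gen_e js)) (x ?g)"
      by (simp add: pair_inv eq p.scale)
    then show ?case by (simp only: snoc.IH[OF c] mult_zero_right)
  qed
  interpret p: Vector_Spaces.linear scl "(*)" "pair (foldl ract covac (map Gen_e js))"
    by (rule pair_lin)
  from vanish[OF count] show ?thesis
    by (simp add: x_def p.diff p.scale p.sum)
qed

text \<open>The covector component is a combination of monomials, to each of which the preceding
  recursion applies. Moving \<open>Gen_f i\<close> back to the covector then produces the eigenvalue
  \<open>\<mu>' i\<close> and lowers the degree on that side too.\<close>

lemma (in verma_action) whittaker_norm_recursion:
  fixes v :: "('i \<Rightarrow> nat) \<Rightarrow> complex" and s :: "'i \<Rightarrow> complex"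
  assumes w: "whittaker_vector scl act vac covac pair \<mu> w"
    and w': "whittaker_covector sclU ract covac vac pair \<mu>' w'"
    and pairing: "verma_pairing sclU ract covac scl act vac pair"
    and v0: "v (\<lambda>_. 0) = 0"
    and v_step: "\<And>\<beta> j. v (\<beta>(j := \<beta> j + 1)) - v \<beta> = s j * (m j - (\<Sum>l\<in>UNIV. of_nat (\<beta> l) * of_int (C l j)))"
  shows "v \<beta> * pair (w' \<beta>) (w \<beta>) = (\<Sum>i\<in>{i. \<beta> i \<noteq> 0}. s i * \<mu> i * \<mu>' i
    * pair (w' (\<beta>(i := \<beta> i - 1))) (w (\<beta>(i := \<beta> i - 1))))"
proof -
  have lin: "Vector_Spaces.linear scl (*) (pair u)" and inv: "pair (ract u g) x = pair u (act g x)"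
    and linU: "Vector_Spaces.linear sclU (*) (\<lambda>u. pair u x)" for u g x
    using pairing by (auto simp: verma_pairing_def)
  \<comment> \<open>Linearity of the pairing in its first argument contains the vector space axioms
    for \<open>sclU\<close>; any second argument serves.\<close>
  interpret U: vector_space sclU
    using linU[of undefined] by (simp add: Vector_Spaces.linear_def)
  have pair_add: "pair (u + u') x = pair u x + pair u' x" and pair_scale: "pair (sclU c u) x = c * pair u x"
    and pair_0: "pair 0 x = 0" "pair u 0 = 0" for u u' c x
  proof -
    interpret p: Vector_Spaces.linear sclU "(*)" "\<lambda>u. pair u x" by (rule linU)
    interpret q: Vector_Spaces.linear scl "(*)" "pair u" by (rule lin)
    show "pair (u + u') x = pair u x + pair u' x" "pair (sclU c u) x = c * pair u x" "pair 0 x = 0" "pair u 0 = 0"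
      by (rule p.add p.scale p.zero q.zero)+
  qed
  have "w' \<beta> \<in> U.span {foldl ract covac (map Gen_e js) | js. \<forall>i. count_list js i = \<beta> i}"
    using w' by (simp add: whittaker_covector_def dual_verma_piece_def)
  then have "v \<beta> * pair (w' \<beta>) (w \<beta>)
      = (\<Sum>i\<in>UNIV. s i * \<mu> i * pair (w' \<beta>) (act (Gen_f i) (shift i w \<beta>)))"
  proof (induction rule: U.span_induct_alt)
    case base
    show ?case by (simp add: pair_0)
  next
    case (step c x y)
    then obtain js where "x = foldl ract covac (map Gen_e js)" "\<forall>i. count_list js i = \<beta> i" by blast
    then have "v \<beta> * pair x (w \<beta>) = (\<Sum>i\<in>UNIV. s i * \<mu> i * pair x (act (Gen_f i) (shift i w \<beta>)))"
      using whittaker_vector_recursion[where v=v and s=s and pair=pair, OF w lin inv v0 v_step] by simp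
    with step.IH have "c * (v \<beta> * pair x (w \<beta>)) + v \<beta> * pair y (w \<beta>)
      = c * (\<Sum>i\<in>UNIV. s i * \<mu> i * pair x (act (Gen_f i) (shift i w \<beta>)))
        + (\<Sum>i\<in>UNIV. s i * \<mu> i * pair y (act (Gen_f i) (shift i w \<beta>)))" by simp
    then show ?case
      by (simp add: pair_add pair_scale sum_distrib_left algebra_simps flip: sum.distrib)
  qed
  also have "\<dots> = (\<Sum>i\<in>{i. \<beta> i \<noteq> 0}. s i * \<mu> i * pair (w' \<beta>) (act (Gen_f i) (shift i w \<beta>)))"
    by (rule sum.mono_neutral_right) (auto simp: shift_def pair_0)
  also have "\<dots> = (\<Sum>i\<in>{i. \<beta> i \<noteq> 0}. s i * \<mu> i * \<mu>' i
    * pair (w' (\<beta>(i := \<beta> i - 1))) (w (\<beta>(i := \<beta> i - 1))))"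
  proof (rule sum.cong[OF refl])
    fix i assume "i \<in> {i. \<beta> i \<noteq> 0}"
    then have i: "\<beta> i \<noteq> 0" by simp
    let ?g = "\<beta>(i := \<beta> i - 1)"
    have "ract (w' (?g(i := ?g i + 1))) (Gen_f i) = sclU (\<mu>' i) (w' ?g)"
      using w' unfolding whittaker_covector_def by blast
    then have "ract (w' \<beta>) (Gen_f i) = sclU (\<mu>' i) (w' ?g)"
      using i by simp
    then have "pair (w' \<beta>) (act (Gen_f i) (shift i w \<beta>)) = \<mu>' i * pair (w' ?g) (w ?g)"
      using i unfolding inv[symmetric] by (simp add: pair_scale shift_def)
    then show "s i * \<mu> i * pair (w' \<beta>) (act (Gen_f i) (shift i w \<beta>))
        = s i * \<mu> i * \<mu>' i * pair (w' ?g) (w ?g)"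
      by simp
  qed
  finally show ?thesis .
qed

text \<open>The component of degree zero is a multiple of \<open>vac\<close>, and the normalization
  of \<open>w\<close> makes the factor 1. The normalization of \<open>w'\<close> gives the
  rest.\<close>

lemma (in verma_action) whittaker_norm_0:
  assumes w: "whittaker_vector scl act vac covac pair \<mu> w"
    and w': "whittaker_covector sclU ract covac vac pair \<mu>' w'"
    and pairing: "verma_pairing sclU ract covac scl act vac pair"
  shows "pair (w' (\<lambda>_. 0)) (w (\<lambda>_. 0)) = 1"
proof -
  interpret p: Vector_Spaces.linear scl "(*)" "pair u" for u
    using pairing by (simp add: verma_pairing_def)
  have "w (\<lambda>_. 0) \<in> verma_piece scl act vac (\<lambda>_. 0)" and one: "pair covac (w (\<lambda>_. 0)) = 1"
    using w by (simp_all add: whittaker_vector_def)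
  then obtain c where c: "w (\<lambda>_. 0) = scl c vac" by (auto simp: piece_0)
  have "pair covac vac = 1" "pair (w' (\<lambda>_. 0)) vac = 1"
    using pairing w' by (simp_all add: verma_pairing_def whittaker_covector_def)
  then show ?thesis using one by (simp add: c p.scale)
qed

section \<open>The partition function\<close>

text \<open>A path with at least one step ends at a weight having a positive coordinate.\<close>

lemma root_paths_0: "root_paths (\<lambda>_. 0) = {[(\<lambda>_. 0)]}"
proof -
  have "p = [\<lambda>_. 0]" if "p \<in> root_paths (\<lambda>_. 0)" for p :: "('a \<Rightarrow> nat) list"
  proof (cases p rule: rev_cases)
    case Nil
    then show ?thesis using that by (simp add: root_paths_def)
  next
    case (snoc q b)
    show ?thesis
    proof (cases q rule: rev_cases)
      case Nil
      then show ?thesis using that snoc by (simp add: root_paths_def)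
    next
      case (snoc q' b')
      have "\<forall>k. Suc k < length p \<longrightarrow> (\<exists>i. p ! Suc k = (p ! k)(i := (p ! k) i + 1))" "last p = (\<lambda>_. 0)"
        using that by (auto simp: root_paths_def)
      then obtain i where "p ! Suc (length q') = (p ! length q')(i := (p ! length q') i + 1)"
        using \<open>p = q @ [b]\<close> snoc by auto
      then have "b = b'(i := b' i + 1)"
        using \<open>p = q @ [b]\<close> snoc by (simp add: nth_append)
      with \<open>last p = _\<close> \<open>p = q @ [b]\<close> have "b'(i := b' i + 1) = (\<lambda>_. 0)" by simp
      then have "(b'(i := b' i + 1)) i = 0" by (rule fun_cong)
      then show ?thesis by simp
    qed
  qed
  then show ?thesis by (auto simp: root_paths_def)
qed

text \<open>Dropping the final vertex leaves a path to a lower neighbour of \<beta>; conversely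
  \<beta> can be appended to every such path.\<close>

lemma root_paths_step:
  assumes "\<beta> \<noteq> (\<lambda>_. 0)"
  shows "root_paths \<beta> = (\<Union>i\<in>{i. \<beta> i \<noteq> 0}. (\<lambda>p. p @ [\<beta>]) ` root_paths (\<beta>(i := \<beta> i - 1)))"
    (is "_ = ?R")
proof (intro equalityI subsetI)
  fix p assume p: "p \<in> root_paths \<beta>"
  then have p': "p \<noteq> []" "hd p = (\<lambda>_. 0)" "last p = \<beta>"
    "\<And>k. Suc k < length p \<Longrightarrow> \<exists>i. p ! Suc k = (p ! k)(i := (p ! k) i + 1)"
    by (auto simp: root_paths_def)
  define q where "q = butlast p"
  have pq: "p = q @ [\<beta>]" using p' by (metis append_butlast_last_id q_def)
  have "q \<noteq> []" using pq p'(2) assms by auto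
  define l where "l = length q - 1"
  have l: "length q = Suc l" using \<open>q \<noteq> []\<close> by (simp add: l_def)
  obtain i where "p ! Suc l = (p ! l)(i := (p ! l) i + 1)" using p'(4)[of l] pq l by auto
  then have i: "\<beta> = (last q)(i := last q i + 1)"
    using pq l \<open>q \<noteq> []\<close> by (simp add: nth_append last_conv_nth)
  have "last q = \<beta>(i := \<beta> i - 1)" "\<beta> i \<noteq> 0" by (subst i, simp)+
  moreover have "q \<in> root_paths (last q)"
  proof -
    have "\<exists>i. q ! Suc k = (q ! k)(i := (q ! k) i + 1)" if "Suc k < length q" for k
      using p'(4)[of k] that by (simp add: pq nth_append)
    then show ?thesis using \<open>q \<noteq> []\<close> p'(2) by (simp add: root_paths_def pq)
  qed
  ultimately show "p \<in> ?R" using pq by auto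
next
  fix p assume "p \<in> ?R"
  then obtain i q where i: "\<beta> i \<noteq> 0" and q: "q \<in> root_paths (\<beta>(i := \<beta> i - 1))" and p: "p = q @ [\<beta>]"
    by blast
  have q': "q \<noteq> []" "hd q = (\<lambda>_. 0)" "last q = \<beta>(i := \<beta> i - 1)"
    "\<And>k. Suc k < length q \<Longrightarrow> \<exists>i. q ! Suc k = (q ! k)(i := (q ! k) i + 1)"
    using q by (auto simp: root_paths_def)
  have "\<exists>i. p ! Suc k = (p ! k)(i := (p ! k) i + 1)" if k: "Suc k < length p" for k
  proof (cases "Suc k < length q")
    case True
    then show ?thesis using q'(4)[of k] by (simp add: p nth_append)
  next
    case False
    then have "length q = Suc k" using k p by simp
    then have "q ! k = \<beta>(i := \<beta> i - 1)" using q'(1,3) by (simp add: last_conv_nth)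
    with \<open>length q = Suc k\<close> i show ?thesis by (intro exI[of _ i]) (simp add: p nth_append)
  qed
  then show "p \<in> root_paths \<beta>" using q' by (simp add: root_paths_def p)
qed

lemma root_paths_nonempty: "p \<in> root_paths \<beta> \<Longrightarrow> p \<noteq> []"
  and root_paths_last: "p \<in> root_paths \<beta> \<Longrightarrow> last p = \<beta>"
  by (simp_all add: root_paths_def)

text \<open>The height of \<beta> serves as the measure for the inductions over degrees.\<close>

lemma sum_lower:
  fixes \<beta> :: "'i::finite \<Rightarrow> nat"
  assumes "\<beta> i \<noteq> 0"
  shows "sum (\<beta>(i := \<beta> i - 1)) UNIV < sum \<beta> UNIV"
  using assms by (intro sum_strict_mono_ex1) (auto intro!: bexI[of _ i])

lemma finite_root_paths: "finite (root_paths (\<beta> :: 'i::finite \<Rightarrow> nat))"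
proof (induction "sum \<beta> UNIV" arbitrary: \<beta> rule: less_induct)
  case less
  show ?case
  proof (cases "\<beta> = (\<lambda>_. 0)")
    case True
    then show ?thesis by (simp add: root_paths_0)
  next
    case False
    have "finite (root_paths (\<beta>(i := \<beta> i - 1)))" if "\<beta> i \<noteq> 0" for i
      using less[OF sum_lower[of \<beta> i, OF that]] .
    then show ?thesis unfolding root_paths_step[OF False] by (intro finite_UN_I finite_imageI) auto
  qed
qed

lemma partition_fun_0: "partition_fun C a d \<Lambda> (\<lambda>_. 0) = 1"
  by (simp add: partition_fun_def root_paths_0)

text \<open>All paths to \<beta> share the last factor
  \<open>1 / vhat C a d \<Lambda> \<beta>\<close>; what remains is the product for the path without
  its last vertex.\<close>

lemma partition_fun_recursion:
  assumes "\<beta> \<noteq> (\<lambda>_. 0)"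
  shows "partition_fun C a d \<Lambda> \<beta>
    = (\<Sum>i\<in>{i. \<beta> i \<noteq> 0}. partition_fun C a d \<Lambda> (\<beta>(i := \<beta> i - 1))) / vhat C a d \<Lambda> \<beta>"
proof -
  let ?g = "\<lambda>p. \<Prod>k = 1..length p - 1. 1 / vhat C a d \<Lambda> (p ! k)"
  let ?P = "\<lambda>i. (\<lambda>p. p @ [\<beta>]) ` root_paths (\<beta>(i := \<beta> i - 1))"
  \<comment> \<open>The end point of the shortened path determines the direction of the last
    step.\<close>
  have disj: "?P i \<inter> ?P j = {}" if "\<beta> i \<noteq> 0" "i \<noteq> j" for i j
  proof (rule ccontr)
    assume "?P i \<inter> ?P j \<noteq> {}"
    then obtain q where "q \<in> root_paths (\<beta>(i := \<beta> i - 1))" "q \<in> root_paths (\<beta>(j := \<beta> j - 1))" by auto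
    then have "\<beta>(i := \<beta> i - 1) = \<beta>(j := \<beta> j - 1)" using root_paths_last by metis
    then have "(\<beta>(i := \<beta> i - 1)) i = (\<beta>(j := \<beta> j - 1)) i" by simp
    then show False using that by simp
  qed
  \<comment> \<open>The product skips index 0, where \<open>vhat\<close> vanishes. As
    \<open>p\<close> is nonempty, the appended vertex has a positive index and adds one
    factor.\<close>
  have g: "?g (p @ [\<beta>]) = ?g p * (1 / vhat C a d \<Lambda> \<beta>)" if ne: "p \<noteq> []" for p
  proof -
    obtain n where n: "length p = Suc n" using ne by (cases p) auto
    have "?g (p @ [\<beta>]) = (\<Prod>k = 1..Suc n. 1 / vhat C a d \<Lambda> ((p @ [\<beta>]) ! k))" by (simp add: n)
    also have "\<dots> = (\<Prod>k = 1..n. 1 / vhat C a d \<Lambda> ((p @ [\<beta>]) ! k)) * (1 / vhat C a d \<Lambda> \<beta>)"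
      by (simp add: nth_append n)
    also have "(\<Prod>k = 1..n. 1 / vhat C a d \<Lambda> ((p @ [\<beta>]) ! k)) = ?g p"
      by (intro prod.cong) (auto simp: nth_append n)
    finally show ?thesis .
  qed
  have "partition_fun C a d \<Lambda> \<beta> = (\<Sum>p\<in>(\<Union>i\<in>{i. \<beta> i \<noteq> 0}. ?P i). ?g p)"
    unfolding partition_fun_def root_paths_step[OF assms] ..
  also have "\<dots> = (\<Sum>i\<in>{i. \<beta> i \<noteq> 0}. \<Sum>p\<in>?P i. ?g p)"
    using disj by (intro sum.UNION_disjoint) (simp_all add: finite_root_paths)
  also have "\<dots> = (\<Sum>i\<in>{i. \<beta> i \<noteq> 0}. \<Sum>p\<in>root_paths (\<beta>(i := \<beta> i - 1)). ?g (p @ [\<beta>]))"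
    by (rule sum.cong[OF refl], subst sum.reindex) (simp_all add: inj_on_def)
  also have "\<dots> = (\<Sum>i\<in>{i. \<beta> i \<noteq> 0}. \<Sum>p\<in>root_paths (\<beta>(i := \<beta> i - 1)). ?g p * (1 / vhat C a d \<Lambda> \<beta>))"
    by (intro sum.cong refl g) (rule root_paths_nonempty)
  finally show ?thesis
    by (simp add: partition_fun_def sum_divide_distrib)
qed

section \<open>Affine weights\<close>

lemma sum_UNIV_option:
  fixes f :: "'n::finite option \<Rightarrow> 'b::comm_monoid_add"
  shows "sum f UNIV = f None + (\<Sum>i\<in>UNIV. f (Some i))"
  by (simp add: UNIV_option_conv sum.reindex)

lemma form_add_left: "form C d (x + y) z = form C d x z + form C d y z"
  and form_diff_left: "form C d (x - y) z = form C d x z - form C d y z"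
  and form_scale_left: "form C d (wscale c x) z = c * form C d x z"
  and form_add_right: "form C d z (x + y) = form C d z x + form C d z y"
  and form_diff_right: "form C d z (x - y) = form C d z x - form C d z y"
  and form_scale_right: "form C d z (wscale c x) = c * form C d z x"
  and form_0_left [simp]: "form C d 0 z = 0"
  and form_0_right [simp]: "form C d z 0 = 0"
  by (simp_all add: form_def wscale_def algebra_simps sum.distrib sum_subtractf sum_distrib_left
      sum_negf)

lemma form_sum_left: "form C d (sum f S) z = (\<Sum>i\<in>S. form C d (f i) z)"
  and form_sum_right: "form C d z (sum f S) = (\<Sum>i\<in>S. form C d z (f i))"
  by (induction S rule: infinite_finite_induct) (simp_all add: form_add_left form_add_right)

lemmas form_linear = form_add_left form_diff_left form_scale_left form_sum_left
  form_add_right form_diff_right form_scale_right form_sum_right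

lemma sum_axis: "(\<Sum>j\<in>UNIV. axis i (1::complex) $ j * f j) = f i"
  by (simp add: axis_def if_distrib[where f="\<lambda>x. x * _"] cong: if_cong)

lemma form_simple_root_right:
  "form C d x (simple_root j) =
    (\<Sum>i\<in>UNIV. snd x $ i * (of_int (C i j) * of_real (d j))) + (if j = None then fst x else 0)"
proof -
  have "(\<Sum>l\<in>UNIV. snd x $ i * axis j 1 $ l * (of_int (C i l) * of_real (d l)))
     = snd x $ i * (of_int (C i j) * of_real (d j))" for i
    using sum_axis[of j "\<lambda>l. snd x $ i * (of_int (C i l) * of_real (d l))"]
    by (simp add: mult.assoc mult.left_commute[of "snd x $ i"])
  then show ?thesis by (simp add: form_def simple_root_def axis_def)
qed

lemma form_phi_hat: "form C d x (phi_hat d \<phi>) = (\<Sum>i\<in>UNIV. \<phi> i * form C d x (coroot d i))"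
  by (simp add: phi_hat_def form_linear)

lemma form_root_weight_right:
  "form C d x (root_weight \<beta>) = (\<Sum>i\<in>UNIV. of_nat (\<beta> i) * form C d x (simple_root i))"
  by (simp add: root_weight_def form_linear)

lemma snd_root_weight: "snd (root_weight \<beta>) $ i = of_nat (\<beta> i)"
  and fst_root_weight: "fst (root_weight \<beta>) = 0"
  by (simp_all add: root_weight_def wscale_def simple_root_def snd_sum fst_sum axis_def
      if_distrib[where f="\<lambda>x. _ * x"] cong: if_cong)

section \<open>Nondegeneracy of the finite Cartan matrix\<close>

text \<open>Multiplying equation \<open>j\<close> by \<open>x j * d j\<close> and summing gives the
  value at \<open>x\<close> of the symmetrized form, which is positive definite.\<close>

lemma simple_cartan_nondegenerate_real:
  fixes x :: "'n::finite \<Rightarrow> real"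
  assumes A: "simple_cartan_matrix A" and x: "\<And>j. (\<Sum>i\<in>UNIV. x i * of_int (A i j)) = 0"
  shows "x = (\<lambda>_. 0)"
proof (rule ccontr)
  assume "x \<noteq> (\<lambda>_. 0)"
  moreover from A obtain d :: "'n \<Rightarrow> real"
    where "\<forall>x :: 'n \<Rightarrow> real. x \<noteq> (\<lambda>_. 0) \<longrightarrow>
      0 < (\<Sum>i\<in>UNIV. \<Sum>j\<in>UNIV. x i * x j * (of_int (A i j) * d j))"
    unfolding simple_cartan_matrix_def by (elim conjE exE)
  ultimately have "0 < (\<Sum>i\<in>UNIV. \<Sum>j\<in>UNIV. x i * x j * (of_int (A i j) * d j))"
    by simp
  also have "\<dots> = (\<Sum>j\<in>UNIV. \<Sum>i\<in>UNIV. x i * x j * (of_int (A i j) * d j))"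
    by (rule sum.swap)
  also have "\<dots> = (\<Sum>j\<in>UNIV. x j * d j * (\<Sum>i\<in>UNIV. x i * of_int (A i j)))"
    by (simp add: sum_distrib_left mult_ac)
  also have "\<dots> = 0" by (simp add: x)
  finally show False by simp
qed

lemma simple_cartan_nondegenerate:
  fixes x :: "'n::finite \<Rightarrow> complex"
  assumes A: "simple_cartan_matrix A" and x: "\<And>j. (\<Sum>i\<in>UNIV. x i * of_int (A i j)) = 0"
  shows "x i = 0"
proof -
  have "(\<Sum>i\<in>UNIV. Re (x i) * of_int (A i j)) = 0" "(\<Sum>i\<in>UNIV. Im (x i) * of_int (A i j)) = 0" for j
    using arg_cong[OF x[of j], of Re] arg_cong[OF x[of j], of Im] by simp_all
  from this[THEN simple_cartan_nondegenerate_real[OF A]]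
  have "(\<lambda>i. Re (x i)) = (\<lambda>_. 0)" "(\<lambda>i. Im (x i)) = (\<lambda>_. 0)" .
  then show ?thesis by (simp add: complex_eq_iff fun_eq_iff)
qed

text \<open>An injective square matrix is invertible. \<open>M\<close> is the transpose of
  \<open>A\<close>, because the sum runs over the first index.\<close>

lemma simple_cartan_solvable:
  fixes b :: "'n::finite \<Rightarrow> complex"
  assumes A: "simple_cartan_matrix A"
  shows "\<exists>x. \<forall>j. (\<Sum>i\<in>UNIV. x i * of_int (A i j)) = b j"
proof -
  define M :: "complex^'n^'n" where "M = (\<chi> j i. of_int (A i j))"
  have "inj ((*v) M)"
  proof (rule injI)
    fix x y assume "M *v x = M *v y"
    then have "(M *v (x - y)) $ j = 0" for j by (simp add: matrix_vector_mult_diff_distrib)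
    then have "(\<Sum>i\<in>UNIV. (x - y) $ i * of_int (A i j)) = 0" for j
      by (simp add: M_def matrix_vector_mult_def mult.commute)
    then have "(x - y) $ i = 0" for i by (rule simple_cartan_nondegenerate[OF A])
    then show "x = y" by (simp add: vec_eq_iff)
  qed
  then obtain B where "B ** M = mat 1" using matrix_left_invertible_injective[of M] by blast
  then have "M ** B = mat 1" using matrix_left_right_inverse by blast
  then have "M *v (B *v (\<chi> j. b j)) = (\<chi> j. b j)"
    by (simp add: matrix_vector_mul_assoc)
  moreover define x where "x = B *v (\<chi> j. b j)"
  ultimately have "(M *v x) $ j = b j" for j by simp
  then have "(\<Sum>i\<in>UNIV. x $ i * of_int (A i j)) = b j" for j
    by (simp add: M_def matrix_vector_mult_def mult.commute)
  then show ?thesis by blast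
qed

lemma finite_weights_add: "x \<in> finite_weights \<Longrightarrow> y \<in> finite_weights \<Longrightarrow> x + y \<in> finite_weights"
  and finite_weights_scale: "x \<in> finite_weights \<Longrightarrow> wscale c x \<in> finite_weights"
  and finite_weights_sum: "(\<And>i. i \<in> S \<Longrightarrow> f i \<in> finite_weights) \<Longrightarrow> sum f S \<in> finite_weights"
  by (simp_all add: finite_weights_def wscale_def fst_sum snd_sum)

section \<open>The bilinear form, fundamental weights and \<open>vhat\<close> in the affine
  case\<close>

locale affine_data =
  fixes C :: "'n::finite option \<Rightarrow> 'n option \<Rightarrow> int" and a :: "'n option \<Rightarrow> nat"
    and d :: "'n option \<Rightarrow> real"
  assumes affine: "untwisted_affine C a d"
begin

lemma d_pos: "0 < d i" and d_None [simp]: "d None = 1" and a_None [simp]: "a None = 1"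
  and C_symm: "of_int (C i j) * d j = of_int (C j i) * d i"
  and marks: "(\<Sum>i\<in>UNIV. int (a i) * C i j) = 0"
  and simple_cartan: "simple_cartan_matrix (\<lambda>i j. C (Some i) (Some j))"
  using affine unfolding untwisted_affine_def by auto

lemma C_diag: "C i i = 2"
  using affine unfolding untwisted_affine_def simple_cartan_matrix_def by (cases i) auto

lemma C_symm': "of_int (C i j) * of_real (d j) = (of_int (C j i) * of_real (d i) :: complex)"
  using arg_cong[OF C_symm[of i j], of complex_of_real] by simp

lemma form_commute: "form C d x y = form C d y x"
proof -
  have "(\<Sum>i\<in>UNIV. \<Sum>j\<in>UNIV. snd x $ i * snd y $ j * (of_int (C i j) * of_real (d j)))
    = (\<Sum>i\<in>UNIV. \<Sum>j\<in>UNIV. snd y $ i * snd x $ j * (of_int (C i j) * of_real (d j)) :: complex)"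
    by (subst sum.swap) (intro sum.cong refl, subst C_symm', simp)
  then show ?thesis by (simp add: form_def)
qed

lemma form_coroot:
  "form C d x (coroot d j) = (\<Sum>i\<in>UNIV. snd x $ i * of_int (C i j)) + (if j = None then fst x else 0)"
  using d_pos[of j] by (simp add: coroot_def form_linear form_simple_root_right sum_divide_distrib
      add_divide_distrib flip: sum_distrib_right mult.assoc)

lemma form_simple_root: "form C d x (simple_root j) = of_real (d j) * form C d x (coroot d j)"
  using d_pos[of j] by (simp add: coroot_def form_linear)

lemma form_root_coroot: "form C d (simple_root i) (coroot d j) = of_int (C i j)"
  by (simp add: form_coroot simple_root_def sum_axis)

lemma form_root_weight_coroot: "form C d (root_weight \<beta>) (coroot d j) = (\<Sum>l\<in>UNIV. of_nat (\<beta> l) * of_int (C l j))"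
  by (simp add: root_weight_def form_linear form_root_coroot)

text \<open>By the mark relation, \<open>delta a\<close> is orthogonal to all simple roots. Only the
  \<open>Lambda0\<close> coordinate of \<open>x\<close> survives, with factor
  \<open>a None = 1\<close>.\<close>

lemma form_delta: "form C d x (delta a) = fst x"
proof -
  have "form C d (delta a) (coroot d j) = 0" for j
  proof -
    have "(\<Sum>l\<in>UNIV. of_nat (a l) * of_int (C l j)) = (of_int (\<Sum>i\<in>UNIV. int (a i) * C i j) :: complex)"
      by simp
    then show ?thesis by (simp only: delta_def form_root_weight_coroot marks of_int_0)
  qed
  then have *: "form C d (delta a) (simple_root j) = 0" for j
    by (simp add: form_simple_root)
  have "x = wscale (fst x) Lambda0 + (\<Sum>i\<in>UNIV. wscale (snd x $ i) (simple_root i))"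
    by (simp add: prod_eq_iff vec_eq_iff wscale_def Lambda0_def simple_root_def snd_sum fst_sum
        axis_def if_distrib[where f="\<lambda>x. _ * x"] cong: if_cong)
  then have "form C d (delta a) x = fst x * form C d (delta a) Lambda0"
    by (metis (no_types, lifting) * form_add_right form_scale_right form_sum_right add_0_right
        mult_zero_right sum.neutral)
  also have "form C d (delta a) Lambda0 = 1"
    by (simp add: form_def Lambda0_def delta_def snd_root_weight fst_root_weight)
  finally show ?thesis by (simp add: form_commute)
qed

lemma form_Lambda0: "form C d x Lambda0 = snd x $ None"
  by (simp add: form_def Lambda0_def)

lemma form_Lambda0_coroot: "form C d Lambda0 (coroot d j) = (if j = None then 1 else 0)"
  by (simp add: form_coroot Lambda0_def)

lemma finite_weights_iff: "x \<in> finite_weights \<longleftrightarrow> form C d x (delta a) = 0 \<and> form C d x Lambda0 = 0"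
  by (simp add: finite_weights_def form_delta form_Lambda0)

lemma finite_weights_eqI:
  assumes "x \<in> finite_weights" "y \<in> finite_weights"
    and "\<And>j. form C d x (coroot d (Some j)) = form C d y (coroot d (Some j))"
  shows "x = y"
proof -
  have "(\<Sum>i\<in>UNIV. snd (x - y) $ Some i * of_int (C (Some i) (Some j))) = 0" for j
    using assms(3)[of j] assms(1,2)
    by (simp add: form_coroot sum_UNIV_option finite_weights_def left_diff_distrib sum_subtractf)
  from simple_cartan_nondegenerate[OF simple_cartan this] have "snd (x - y) $ Some i = 0" for i .
  then have "snd x $ i = snd y $ i" for i
    using assms(1,2) by (cases i) (auto simp: finite_weights_def)
  then show ?thesis using assms(1,2) by (simp add: prod_eq_iff vec_eq_iff finite_weights_def)
qed

text \<open>Solvability of the Cartan system gives existence and nondegeneracy gives uniqueness, so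
  the definite description in \<open>fund_weight\<close> denotes.\<close>

lemma fund_weight:
  shows form_fund_weight: "form C d (fund_weight C a d i) (coroot d (Some j)) = (if i = j then 1 else 0)"
    and fund_weight_finite: "fund_weight C a d i \<in> finite_weights"
proof -
  obtain x where x: "\<And>j. (\<Sum>l\<in>UNIV. x l * of_int (C (Some l) (Some j))) = (if i = j then 1 else 0 :: complex)"
    using simple_cartan_solvable[OF simple_cartan, of "\<lambda>j. if i = j then 1 else 0"] by blast
  define y :: "'n weight" where "y = (0, \<chi> l. case l of None \<Rightarrow> 0 | Some l \<Rightarrow> x l)"
  let ?P = "\<lambda>x. (\<forall>j. form C d x (coroot d (Some j)) = (if i = j then 1 else 0)) \<and>
     form C d x (delta a) = 0 \<and> form C d x Lambda0 = 0"
  have "?P y"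
    by (simp add: form_coroot sum_UNIV_option y_def x form_delta form_Lambda0)
  moreover have "z = y" if "?P z" for z
    using that \<open>?P y\<close> by (intro finite_weights_eqI) (simp_all add: finite_weights_iff)
  ultimately have "?P (fund_weight C a d i)"
    unfolding fund_weight_def by (rule theI)
  then show "form C d (fund_weight C a d i) (coroot d (Some j)) = (if i = j then 1 else 0)"
    "fund_weight C a d i \<in> finite_weights" by (simp_all add: finite_weights_iff)
qed

lemma rho_finite: "rho C a d \<in> finite_weights"
  by (simp add: rho_def finite_weights_sum fund_weight_finite)

text \<open>At the affine node, orthogonality of \<open>rho\<close> to \<open>delta\<close> forces
  \<open>rho\<close> to pair with the coroot to 1 minus the dual Coxeter number; the
  \<open>Lambda0\<close> part restores the difference.\<close>

lemma form_rho_hat_coroot: "form C d (rho_hat C a d) (coroot d j) = 1"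
proof -
  have rho: "form C d (rho C a d) (coroot d (Some j)) = 1" for j
    by (simp add: rho_def form_linear form_fund_weight)
  have "0 = form C d (rho C a d) (delta a)"
    using rho_finite by (simp add: finite_weights_iff)
  also have "\<dots> = form C d (rho C a d) (coroot d None) + (\<Sum>i\<in>UNIV. of_nat (a (Some i)) * of_real (d (Some i)))"
    by (simp add: delta_def form_root_weight_right form_simple_root sum_UNIV_option rho)
  finally show ?thesis
    by (cases j) (simp_all add: rho_hat_def form_linear form_Lambda0_coroot rho dual_coxeter_def
        sum_UNIV_option add_eq_0_iff mult.commute)
qed

lemma root_weight_add_simple: "root_weight (\<beta>(j := \<beta> j + 1)) = root_weight \<beta> + simple_root j"
  by (simp add: prod_eq_iff vec_eq_iff snd_root_weight fst_root_weight simple_root_def axis_def)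

lemma vhat_0: "vhat C a d \<Lambda> (\<lambda>_. 0) = 0"
  by (simp add: vhat_def root_weight_def wscale_def form_sum_right zero_prod_def[symmetric])

text \<open>The contribution \<open>d j\<close> of \<open>rho_hat\<close> cancels half the norm of
  the simple root. What is left is \<open>d j\<close> times the eigenvalue of \<open>Gen_h j\<close>
  in degree \<beta>, as the Whittaker recursion requires.\<close>

lemma vhat_step:
  "vhat C a d \<Lambda> (\<beta>(j := \<beta> j + 1)) - vhat C a d \<Lambda> \<beta>
    = of_real (d j) * (form C d \<Lambda> (coroot d j) - (\<Sum>l\<in>UNIV. of_nat (\<beta> l) * of_int (C l j)))"
proof -
  have "form C d (simple_root j) (root_weight \<beta>) = form C d (root_weight \<beta>) (simple_root j)"
    by (rule form_commute)
  then show ?thesis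
    unfolding vhat_def root_weight_add_simple
    by (simp add: form_linear form_simple_root form_rho_hat_coroot form_root_coroot C_diag
        form_root_weight_coroot algebra_simps)
qed

text \<open>The fundamental weights form the basis dual to the finite simple coroots.\<close>

lemma finite_weight_expansion:
  assumes "z \<in> finite_weights"
  shows "z = (\<Sum>i\<in>UNIV. wscale (form C d z (coroot d (Some i))) (fund_weight C a d i))"
  using assms
  by (intro finite_weights_eqI finite_weights_sum finite_weights_scale fund_weight_finite)
    (simp_all add: form_linear form_fund_weight if_distrib[where f="\<lambda>x. _ * x"] cong: if_cong)

text \<open>The weight \<open>\<Lambda> + rho_hat - \<beta>\<close> equals \<open>(k + h\<^sup>\<or>) \<Lambda>\<^sub>0 + z - \<beta>\<^sub>0 \<delta>\<close> with \<open>z\<close> a weight of the finite-dimensional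
  algebra; both \<open>\<Lambda>\<^sub>0\<close> and \<open>\<delta>\<close> are orthogonal to the coroots of that algebra, so the sum is \<open>(z | z)\<close>.\<close>

lemma laplacian_eigenvalue:
  assumes "\<Lambda> = wscale k Lambda0 + lam" "lam \<in> finite_weights"
  defines "c \<equiv> \<lambda>\<beta> i. form C d (\<Lambda> + rho_hat C a d - root_weight \<beta>) (coroot d (Some i))"
  shows "1/2 * (\<Sum>i\<in>UNIV. \<Sum>j\<in>UNIV. form C d (fund_weight C a d i) (fund_weight C a d j) * (c \<beta> i * c \<beta> j))
    = 1/2 * form C d (lam + rho C a d) (lam + rho C a d) + (k + dual_coxeter a d) * of_nat (\<beta> None)
      - vhat C a d \<Lambda> \<beta>"
proof -
  define K where "K = k + dual_coxeter a d"
  define b :: complex where "b = of_nat (\<beta> None)"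
  define y where "y = lam + rho C a d"
  define z where "z = y - root_weight \<beta> + wscale b (delta a)"
  have y: "y \<in> finite_weights" unfolding y_def by (intro finite_weights_add rho_finite assms)
  have z: "z \<in> finite_weights"
    using y by (simp add: z_def finite_weights_def delta_def wscale_def snd_root_weight
        fst_root_weight b_def)
  have split: "\<Lambda> + rho_hat C a d = wscale K Lambda0 + y"
    by (simp add: assms rho_hat_def y_def K_def wscale_def Lambda0_def)
  have delta_left: "form C d (delta a) x = fst x" for x
    using form_delta[of x] by (simp add: form_commute)
  have Lambda0_left: "form C d Lambda0 x = snd x $ None" for x
    using form_Lambda0[of x] by (simp add: form_commute)
  have c: "c \<beta> i = form C d z (coroot d (Some i))" for i
    unfolding c_def split z_def
    by (simp add: form_linear form_Lambda0_coroot delta_left)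
      (simp add: coroot_def wscale_def simple_root_def)
  let ?S = "\<Sum>i\<in>UNIV. \<Sum>j\<in>UNIV. form C d (fund_weight C a d i) (fund_weight C a d j) * (c \<beta> i * c \<beta> j)"
  have "?S = form C d (\<Sum>i\<in>UNIV. wscale (c \<beta> i) (fund_weight C a d i)) (\<Sum>i\<in>UNIV. wscale (c \<beta> i) (fund_weight C a d i))"
    unfolding form_linear by (subst sum.swap) (simp add: sum_distrib_left mult_ac)
  also have "\<dots> = form C d z z"
    unfolding c finite_weight_expansion[OF z, symmetric] ..
  \<comment> \<open>The multiple of \<open>delta a\<close> drops out: it is orthogonal to
    \<open>y\<close>, to \<open>root_weight \<beta>\<close> and to itself.\<close>
  also have "\<dots> = form C d y y - 2 * form C d y (root_weight \<beta>) + form C d (root_weight \<beta>) (root_weight \<beta>)"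
  proof -
    have "fst y = 0" "fst (root_weight \<beta>) = 0" "fst (delta a) = 0"
      using y by (simp_all add: finite_weights_def fst_root_weight delta_def)
    then show ?thesis
      using form_commute[of "root_weight \<beta>" y] by (simp add: z_def form_linear form_delta delta_left)
  qed
  finally have norm_z: "?S = \<dots>" .
  \<comment> \<open>The level term arises from \<open>vhat\<close>, where \<open>K\<close> times
    \<open>Lambda0\<close> pairs with \<open>root_weight \<beta>\<close> to
    \<open>K * b\<close>.\<close>
  show ?thesis
    unfolding norm_z vhat_def split
    by (simp add: form_linear Lambda0_left snd_root_weight b_def[symmetric] K_def[symmetric] y_def[symmetric]
      field_simps)
qed

end

section \<open>The Toda equation\<close>

lemma prod_power_lower:
  fixes \<nu> :: "'i::finite \<Rightarrow> 'a::comm_semiring_1"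
  assumes "\<beta> i \<noteq> 0"
  shows "(\<Prod>j\<in>UNIV. \<nu> j ^ \<beta> j) = \<nu> i * (\<Prod>j\<in>UNIV. \<nu> j ^ (\<beta>(i := \<beta> i - 1)) j)"
proof -
  have "(\<Prod>j\<in>UNIV - {i}. \<nu> j ^ \<beta> j) = (\<Prod>j\<in>UNIV - {i}. \<nu> j ^ (\<beta>(i := \<beta> i - 1)) j)"
    by (rule prod.cong) auto
  moreover have "\<nu> i ^ \<beta> i = \<nu> i * \<nu> i ^ (\<beta> i - 1)"
    using assms by (cases "\<beta> i") auto
  ultimately show ?thesis
    by (simp add: prod.remove[of UNIV i] mult.assoc)
qed

text \<open>The Euler operator is diagonal on monomials; at \<open>\<beta> j = 0\<close> both sides
  vanish.\<close>

lemma nu_mult_nu_deriv: "nu_mult j (nu_deriv j G) = (\<lambda>\<beta> \<phi>. of_nat (\<beta> j) * G \<beta> \<phi>)"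
  by (intro ext) (simp add: nu_mult_def nu_deriv_def flip: of_nat_Suc)

text \<open>The exponent is affine in each single variable. The result has the shape of the argument
  with a new \<open>g\<close>, so the rule can be iterated for second derivatives.\<close>

lemma phi_deriv_exp:
  fixes Y :: "('n::finite option \<Rightarrow> nat) \<Rightarrow> 'n weight"
  shows "phi_deriv i (\<lambda>\<beta> \<phi>. g \<beta> * exp (form C d (Y \<beta>) (phi_hat d \<phi>)))
    = (\<lambda>\<beta> \<phi>. g \<beta> * form C d (Y \<beta>) (coroot d i) * exp (form C d (Y \<beta>) (phi_hat d \<phi>)))"
proof (intro ext)
  fix \<beta> :: "'n option \<Rightarrow> nat" and \<phi> :: "'n option \<Rightarrow> complex"
  define k where "k = form C d (Y \<beta>) (coroot d i)"
  define r where "r = (\<Sum>j\<in>UNIV - {i}. \<phi> j * form C d (Y \<beta>) (coroot d j))"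
  have affine_in_t: "form C d (Y \<beta>) (phi_hat d (\<phi>(i := t))) = t * k + r" for t
    by (simp add: form_phi_hat sum.remove[of UNIV i] k_def r_def)
  have "((\<lambda>t. g \<beta> * exp (t * k + r)) has_field_derivative g \<beta> * k * exp (t * k + r)) (at t)" for t
    by (auto intro!: derivative_eq_intros)
  from DERIV_imp_deriv[OF this[of "\<phi> i"]]
  show "phi_deriv i (\<lambda>\<beta> \<phi>. g \<beta> * exp (form C d (Y \<beta>) (phi_hat d \<phi>))) \<beta> \<phi>
    = g \<beta> * form C d (Y \<beta>) (coroot d i) * exp (form C d (Y \<beta>) (phi_hat d \<phi>))"
    using affine_in_t[of "\<phi> i"] by (simp add: phi_deriv_def affine_in_t k_def)
qed

section \<open>The partition series as an eigenfunction of the Toda operator\<close>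

context affine_data
begin

text \<open>Clearing the denominator extends the recursion to \<beta> = 0, where the sum is empty
  and \<open>vhat\<close> is zero.\<close>

lemma partition_fun_recursion_vhat:
  assumes "\<forall>\<beta>. \<beta> \<noteq> (\<lambda>_. 0) \<longrightarrow> vhat C a d \<Lambda> \<beta> \<noteq> 0"
  shows "(\<Sum>i\<in>{i. \<beta> i \<noteq> 0}. partition_fun C a d \<Lambda> (\<beta>(i := \<beta> i - 1)))
    = vhat C a d \<Lambda> \<beta> * partition_fun C a d \<Lambda> \<beta>"
proof (cases "\<beta> = (\<lambda>_. 0)")
  case True
  then show ?thesis by (simp add: vhat_0)
next
  case False
  then show ?thesis using assms partition_fun_recursion[OF False] by simp
qed

text \<open>Since \<open>vhat\<close> is nonzero away from 0, the recursion and the start value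
  determine \<open>p\<close>. The right-hand side solves it, each step contributing one factor
  \<open>\<nu> i\<close>.\<close>

lemma whittaker_norm_partition_fun:
  assumes vhat: "\<forall>\<beta>. \<beta> \<noteq> (\<lambda>_. 0) \<longrightarrow> vhat C a d \<Lambda> \<beta> \<noteq> 0"
    and p0: "p (\<lambda>_. 0) = 1"
    and rec: "\<And>\<beta>. vhat C a d \<Lambda> \<beta> * p \<beta> = (\<Sum>i\<in>{i. \<beta> i \<noteq> 0}. \<nu> i * p (\<beta>(i := \<beta> i - 1)))"
  shows "p \<beta> = (\<Prod>i\<in>UNIV. \<nu> i ^ \<beta> i) * partition_fun C a d \<Lambda> \<beta>"
proof (induction "sum \<beta> UNIV" arbitrary: \<beta> rule: less_induct)
  case less
  show ?case
  proof (cases "\<beta> = (\<lambda>_. 0)")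
    case True
    then show ?thesis by (simp add: p0 partition_fun_0)
  next
    case False
    have "vhat C a d \<Lambda> \<beta> * p \<beta> = (\<Sum>i\<in>{i. \<beta> i \<noteq> 0}. \<nu> i * ((\<Prod>j\<in>UNIV. \<nu> j ^ (\<beta>(i := \<beta> i - 1)) j)
        * partition_fun C a d \<Lambda> (\<beta>(i := \<beta> i - 1))))"
      unfolding rec
    proof (rule sum.cong[OF refl])
      fix i assume "i \<in> {i. \<beta> i \<noteq> 0}"
      then have "\<beta> i \<noteq> 0" by simp
      from less[OF sum_lower[of \<beta> i, OF this]]
      show "\<nu> i * p (\<beta>(i := \<beta> i - 1)) = \<nu> i * ((\<Prod>j\<in>UNIV. \<nu> j ^ (\<beta>(i := \<beta> i - 1)) j)
        * partition_fun C a d \<Lambda> (\<beta>(i := \<beta> i - 1)))" by (rule arg_cong)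
    qed
    also have "\<dots> = (\<Sum>i\<in>{i. \<beta> i \<noteq> 0}. (\<Prod>j\<in>UNIV. \<nu> j ^ \<beta> j) * partition_fun C a d \<Lambda> (\<beta>(i := \<beta> i - 1)))"
    proof (rule sum.cong[OF refl])
      fix i assume "i \<in> {i. \<beta> i \<noteq> 0}"
      then have "\<beta> i \<noteq> 0" by simp
      then show "\<nu> i * ((\<Prod>j\<in>UNIV. \<nu> j ^ (\<beta>(i := \<beta> i - 1)) j) * partition_fun C a d \<Lambda> (\<beta>(i := \<beta> i - 1)))
          = (\<Prod>j\<in>UNIV. \<nu> j ^ \<beta> j) * partition_fun C a d \<Lambda> (\<beta>(i := \<beta> i - 1))"
        unfolding prod_power_lower[of \<beta> i \<nu>, OF \<open>\<beta> i \<noteq> 0\<close>] by (simp only: mult.assoc)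
    qed
    also have "\<dots> = vhat C a d \<Lambda> \<beta> * ((\<Prod>j\<in>UNIV. \<nu> j ^ \<beta> j) * partition_fun C a d \<Lambda> \<beta>)"
      unfolding sum_distrib_left[symmetric] partition_fun_recursion_vhat[OF vhat] by (rule mult.left_commute)
    finally show ?thesis using vhat False by simp
  qed
qed

lemma toda_partition_series:
  assumes Lambda: "\<Lambda> = wscale k Lambda0 + lam" "lam \<in> finite_weights"
    and vhat: "\<forall>\<beta>. \<beta> \<noteq> (\<lambda>_. 0) \<longrightarrow> vhat C a d \<Lambda> \<beta> \<noteq> 0"
  defines "G \<equiv> \<lambda>\<beta> \<phi>. partition_fun C a d \<Lambda> \<beta>
    * exp (form C d (\<Lambda> + rho_hat C a d - root_weight \<beta>) (phi_hat d \<phi>))"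
  shows "toda_operator C a d k G \<beta> \<phi> = 1/2 * form C d (lam + rho C a d) (lam + rho C a d) * G \<beta> \<phi>"
proof -
  let ?c = "\<lambda>i. form C d (\<Lambda> + rho_hat C a d - root_weight \<beta>) (coroot d (Some i))"
  define L where "L = (\<Sum>i\<in>UNIV. \<Sum>j\<in>UNIV. form C d (fund_weight C a d i) (fund_weight C a d j) * (?c i * ?c j))"
  have laplacian: "1/2 * L = 1/2 * form C d (lam + rho C a d) (lam + rho C a d)
      + (k + dual_coxeter a d) * of_nat (\<beta> None) - vhat C a d \<Lambda> \<beta>"
    unfolding L_def by (rule laplacian_eigenvalue[OF Lambda])
  have "phi_deriv (Some i) (phi_deriv (Some j) G) \<beta> \<phi> = ?c i * ?c j * G \<beta> \<phi>" for i j
    unfolding G_def phi_deriv_exp by (simp only: mult_ac)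
  then have second_order: "(\<Sum>i\<in>UNIV. \<Sum>j\<in>UNIV. form C d (fund_weight C a d i) (fund_weight C a d j)
      * phi_deriv (Some i) (phi_deriv (Some j) G) \<beta> \<phi>) = L * G \<beta> \<phi>"
    by (simp only: L_def sum_distrib_right mult.assoc)
  \<comment> \<open>The potential factor compensates for the change of degree, so all lower
    neighbours carry the exponential of degree \<beta>.\<close>
  have lower: "exp (- form C d (simple_root j) (phi_hat d \<phi>)) * G (\<beta>(j := \<beta> j - 1)) \<phi>
      = partition_fun C a d \<Lambda> (\<beta>(j := \<beta> j - 1))
        * exp (form C d (\<Lambda> + rho_hat C a d - root_weight \<beta>) (phi_hat d \<phi>))" if "\<beta> j \<noteq> 0" for j
  proof -
    have "root_weight \<beta> = root_weight (\<beta>(j := \<beta> j - 1)) + simple_root j"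
      using root_weight_add_simple[of "\<beta>(j := \<beta> j - 1)" j] that by simp
    then show ?thesis
      by (simp add: G_def form_linear exp_add exp_diff exp_minus field_simps)
  qed
  have "(\<Sum>j\<in>UNIV. exp (- form C d (simple_root j) (phi_hat d \<phi>)) * nu_mult j G \<beta> \<phi>)
      = (\<Sum>j\<in>{j. \<beta> j \<noteq> 0}. exp (- form C d (simple_root j) (phi_hat d \<phi>)) * nu_mult j G \<beta> \<phi>)"
    by (rule sum.mono_neutral_right) (auto simp: nu_mult_def)
  also have "\<dots> = (\<Sum>j\<in>{j. \<beta> j \<noteq> 0}. partition_fun C a d \<Lambda> (\<beta>(j := \<beta> j - 1))
        * exp (form C d (\<Lambda> + rho_hat C a d - root_weight \<beta>) (phi_hat d \<phi>)))"
    using lower by (intro sum.cong refl) (simp add: nu_mult_def)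
  also have "\<dots> = vhat C a d \<Lambda> \<beta> * G \<beta> \<phi>"
    by (simp only: G_def partition_fun_recursion_vhat[OF vhat] mult.assoc flip: sum_distrib_right)
  finally have potential: "(\<Sum>j\<in>UNIV. exp (- form C d (simple_root j) (phi_hat d \<phi>)) * nu_mult j G \<beta> \<phi>)
      = vhat C a d \<Lambda> \<beta> * G \<beta> \<phi>" .
  have "toda_operator C a d k G \<beta> \<phi>
      = (- (k + dual_coxeter a d) * of_nat (\<beta> None) + 1/2 * L + vhat C a d \<Lambda> \<beta>) * G \<beta> \<phi>"
    unfolding toda_operator_def second_order potential nu_mult_nu_deriv by (simp only: distrib_right mult.assoc)
  \<comment> \<open>The level terms cancel, and so do the two occurrences of \<open>vhat\<close>;
    the energy remains.\<close>
  then show ?thesis unfolding laplacian by (simp add: algebra_simps)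
qed

end

theorem theorem4p5:
  fixes C :: "'n::finite option \<Rightarrow> 'n option \<Rightarrow> int"
    and a :: "'n option \<Rightarrow> nat" and d :: "'n option \<Rightarrow> real"
    and k :: complex and lam \<Lambda> :: "'n weight"
    and \<mu> \<mu>' \<nu> :: "'n option \<Rightarrow> complex"
    and sclV :: "complex \<Rightarrow> 'v \<Rightarrow> 'v::ab_group_add"
    and act :: "'n option chevalley \<Rightarrow> 'v \<Rightarrow> 'v" and vac :: 'v
    and sclU :: "complex \<Rightarrow> 'u \<Rightarrow> 'u::ab_group_add"
    and ract :: "'u \<Rightarrow> 'n option chevalley \<Rightarrow> 'u" and covac :: 'u
    and pair :: "'u \<Rightarrow> 'v \<Rightarrow> complex"
    and w :: "('n option \<Rightarrow> nat) \<Rightarrow> 'v" and w' :: "('n option \<Rightarrow> nat) \<Rightarrow> 'u"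
  assumes affine: "untwisted_affine C a d"
    and Lambda: "\<Lambda> = wscale k Lambda0 + lam"
    and nu: "\<nu> = (\<lambda>j. of_real (d j) * \<mu> j * \<mu>' j)"
    and weight: "lam \<in> finite_weights"
    and level: "\<forall>m::nat. m > 0 \<longrightarrow> k \<noteq> of_nat m"
    and noncritical: "k \<noteq> - dual_coxeter a d"
    and verma: "verma_module C (\<lambda>i. form C d \<Lambda> (coroot d i)) sclV act vac"
    and dual_verma: "dual_verma_module C (\<lambda>i. form C d \<Lambda> (coroot d i)) sclU ract covac"
    and pairing: "verma_pairing sclU ract covac sclV act vac pair"
    and generic_irreducible: "irreducible_module sclV act"
    and generic_vhat: "\<forall>\<beta>. \<beta> \<noteq> (\<lambda>_. 0) \<longrightarrow> vhat C a d \<Lambda> \<beta> \<noteq> 0"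
    and mu: "\<forall>i. \<mu> i \<noteq> 0" and mu': "\<forall>i. \<mu>' i \<noteq> 0"
    and whittaker: "whittaker_vector sclV act vac covac pair \<mu> w"
    and cowhittaker: "whittaker_covector sclU ract covac vac pair \<mu>' w'"
  shows "(\<forall>\<beta> \<phi>. modified_whittaker_fun C d \<Lambda> sclV pair w' w \<beta> \<phi> =
            (\<Prod>i\<in>UNIV. \<nu> i ^ \<beta> i)
            * exp (form C d (\<Lambda> + rho_hat C a d - root_weight \<beta>) (phi_hat d \<phi>))
            * partition_fun C a d \<Lambda> \<beta>)
       \<and> toda_operator C a d k (nu_expansion \<nu> (modified_whittaker_fun C d \<Lambda> sclV pair w' w)) =
           (\<lambda>\<beta> \<phi>. 1/2 * form C d (lam + rho C a d) (lam + rho C a d)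
                  * nu_expansion \<nu> (modified_whittaker_fun C d \<Lambda> sclV pair w' w) \<beta> \<phi>)"
proof -
  interpret affine_data C a d by unfold_locales (rule affine)
  interpret verma_action C "\<lambda>i. form C d \<Lambda> (coroot d i)" sclV act vac
    by unfold_locales (rule verma)
  \<comment> \<open>With \<open>s = d\<close> the coefficient
    \<open>s i * \<mu> i * \<mu>' i\<close> of the Whittaker recursion is
    \<open>\<nu> i\<close>.\<close>
  have norm: "pair (w' \<beta>) (w \<beta>) = (\<Prod>i\<in>UNIV. \<nu> i ^ \<beta> i) * partition_fun C a d \<Lambda> \<beta>" for \<beta>
    using whittaker_norm_recursion[OF whittaker cowhittaker pairing vhat_0 vhat_step]
    by (intro whittaker_norm_partition_fun[where p="\<lambda>\<beta>. pair (w' \<beta>) (w \<beta>)"] generic_vhat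
        whittaker_norm_0[OF whittaker cowhittaker pairing]) (simp add: nu)
  have modified: "modified_whittaker_fun C d \<Lambda> sclV pair w' w \<beta> \<phi> =
            (\<Prod>i\<in>UNIV. \<nu> i ^ \<beta> i)
            * exp (form C d (\<Lambda> + rho_hat C a d - root_weight \<beta>) (phi_hat d \<phi>))
            * partition_fun C a d \<Lambda> \<beta>" for \<beta> \<phi>
  proof -
    interpret p: Vector_Spaces.linear sclV "(*)" "pair (w' \<beta>)"
      using pairing by (simp add: verma_pairing_def)
    \<comment> \<open>The prefactor of the modified function is thus the shift of \<Lambda> by
      \<open>rho_hat\<close> in the exponent.\<close>
    have "form C d (rho_hat C a d) (phi_hat d \<phi>) = (\<Sum>i\<in>UNIV. \<phi> i)"
      by (simp add: form_phi_hat form_rho_hat_coroot)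
    then show ?thesis
      by (simp add: modified_whittaker_fun_def whittaker_fun_def torus_exp_def p.scale norm
          form_add_left form_diff_left exp_add exp_diff)
  qed
  \<comment> \<open>Division by the monomial in \<open>nu_expansion\<close> is then genuine and
    returns the coefficient.\<close>
  have "\<nu> i \<noteq> 0" for i
    using mu mu' d_pos[of i] by (simp add: nu)
  then have expansion: "nu_expansion \<nu> (modified_whittaker_fun C d \<Lambda> sclV pair w' w)
    = (\<lambda>\<beta> \<phi>. partition_fun C a d \<Lambda> \<beta>
        * exp (form C d (\<Lambda> + rho_hat C a d - root_weight \<beta>) (phi_hat d \<phi>)))"
    by (intro ext) (simp add: nu_expansion_def modified)
  show ?thesis
    unfolding expansion using modified toda_partition_series[OF Lambda weight generic_vhat]
    by (intro conjI allI ext)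
qed

end
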